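(* Let $F$ be a field of arbitrary characteristic and let $(V,b)$ be a non-degenerate $F$-bilinear space. There is a one-to-one correspondence between the set of similarity classes of non-degenerate $F$-bilinear spaces $(V',b')$ such that $a_{b'}$ is conjugate to $a_b$, and the quotient set $\mathrm{Sym}(\mathscr{C}_b,* )^\times/\sim$. This correspondence sends the equivalence class of $u\in\mathrm{Sym}(\mathscr{C}_b,* )^\times$ to the similarity class of $(V,b_u)$, where $b_u(x,y)=b(x,u^{-1}(y))$ for all $x,y\in V$, and sends the similarity class of $(V',b')$ to the equivalence class of the unique automorphism $u_{b'}$ of $V$ defined by $$b'(f(x),f(y))=b(x,u_{b'}^{-1}(y))\quad\text{for all }x,y\in V,$$ where $f:V\to V'$ is a linear isomorphism satisfying $a_{b'}=fa_bf^{-1}$.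
   Context: An $F$-bilinear space $(V,b)$ is a finite-dimensional $F$-vector space $V$ with an $F$-bilinear form $b$ (no symmetry assumed). For $b$ non-degenerate, the asymmetry of $b$ is the unique endomorphism $a_b$ of $V$ with $b(x,y)=b(y,a_b(x))$ for all $x,y\in V$, and $\sigma_b$ is the anti-automorphism of the algebra $\mathscr{L}(V)$ of endomorphisms of $V$ defined by $b(f(x),y)=b(x,\sigma_b(f)(y))$ for all $x,y$. $\mathscr{C}_b$ is the centralizer of $a_b$ in $\mathscr{L}(V)$; the restriction of $\sigma_b$ to $\mathscr{C}_b$ is an involution, denoted by $*$. $\mathrm{Sym}(\mathscr{C}_b,* )^\times$ is the set of invertible elements $u\in\mathscr{C}_b$ with $u^*=u$. For $u_1,u_2\in\mathrm{Sym}(\mathscr{C}_b,* )^\times$, write $u_1\sim u_2$ if there are $v\in\mathscr{C}_b^\times$ and $\lambda\in F^\times$ with $u_2=\lambda vu_1v^*$; this is an equivalence relation. $a_{b'}$ (on $V'$) and $a_b$ (on $V$) are conjugate if $a_{b'}=fa_bf^{-1}$ for some linear isomorphism $f:V\to V'$. $(V,b)$ and $(V',b')$ are similar if there are a linear isomorphism $g:V\to V'$ and $\lambda\in F^\times$ with $b'(g(x),g(y))=\lambda b(x,y)$ for all $x,y\in V$. *)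

theory Defs
  imports "Jordan_Normal_Form.Missing_VectorSpace"
begin

text \<open>
  Conventions: fields, vector spaces, linear maps and finite dimension are those of
  \<open>HOL-Algebra\<close> and of the locales \<open>vectorspace\<close> and \<open>linear_map\<close>. A bilinear space is a pair
  \<open>(V, b)\<close>; only the values of \<open>b\<close> on the carrier of \<open>V\<close> are meaningful. Endomorphisms, in
  contrast, are taken to be \<open>extensional\<close> (equal to \<open>undefined\<close> off the carrier), so that two
  endomorphisms are equal as HOL functions iff they agree on the carrier.
\<close>

locale bilinear_space = vectorspace K V
  for K (structure) and V (structure) +
  fixes b :: "'c \<Rightarrow> 'c \<Rightarrow> 'a"
  assumes finite_dimensional: "fin_dim"
    and form_closed: "\<lbrakk>x \<in> carrier V; y \<in> carrier V\<rbrakk> \<Longrightarrow> b x y \<in> carrier K"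
    and form_add_left: "\<lbrakk>x \<in> carrier V; x' \<in> carrier V; y \<in> carrier V\<rbrakk>
      \<Longrightarrow> b (x \<oplus>\<^bsub>V\<^esub> x') y = b x y \<oplus>\<^bsub>K\<^esub> b x' y"
    and form_add_right: "\<lbrakk>x \<in> carrier V; y \<in> carrier V; y' \<in> carrier V\<rbrakk>
      \<Longrightarrow> b x (y \<oplus>\<^bsub>V\<^esub> y') = b x y \<oplus>\<^bsub>K\<^esub> b x y'"
    and form_smult_left: "\<lbrakk>r \<in> carrier K; x \<in> carrier V; y \<in> carrier V\<rbrakk>
      \<Longrightarrow> b (r \<odot>\<^bsub>V\<^esub> x) y = r \<otimes>\<^bsub>K\<^esub> b x y"
    and form_smult_right: "\<lbrakk>r \<in> carrier K; x \<in> carrier V; y \<in> carrier V\<rbrakk>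
      \<Longrightarrow> b x (r \<odot>\<^bsub>V\<^esub> y) = r \<otimes>\<^bsub>K\<^esub> b x y"

locale nondegenerate_bilinear_space = bilinear_space +
  assumes left_nondegenerate:
      "\<lbrakk>x \<in> carrier V; \<And>y. y \<in> carrier V \<Longrightarrow> b x y = \<zero>\<^bsub>K\<^esub>\<rbrakk> \<Longrightarrow> x = \<zero>\<^bsub>V\<^esub>"
    and right_nondegenerate:
      "\<lbrakk>y \<in> carrier V; \<And>x. x \<in> carrier V \<Longrightarrow> b x y = \<zero>\<^bsub>K\<^esub>\<rbrakk> \<Longrightarrow> y = \<zero>\<^bsub>V\<^esub>"

definition linear_iso where
  "linear_iso K V W f \<longleftrightarrow> linear_map K V W f \<and> bij_betw f (carrier V) (carrier W)"

definition end_algebra ::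
  "('k, 'r) ring_scheme \<Rightarrow> ('k, 'v) module \<Rightarrow> ('k, 'v \<Rightarrow> 'v) module" where
  "end_algebra K V =
    \<lparr>carrier = {f. linear_map K V V f} \<inter> extensional (carrier V),
     mult = compose (carrier V),
     one = (\<lambda>x\<in>carrier V. x),
     zero = (\<lambda>x\<in>carrier V. \<zero>\<^bsub>V\<^esub>),
     add = (\<lambda>f g. \<lambda>x\<in>carrier V. f x \<oplus>\<^bsub>V\<^esub> g x),
     smult = (\<lambda>r f. \<lambda>x\<in>carrier V. r \<odot>\<^bsub>V\<^esub> f x)\<rparr>"

text \<open>
  The unique existence required by the next two definite descriptions holds for every
  non-degenerate bilinear space. \<open>adjoint_inv\<close> is \<open>\<sigma>\<^sub>b\<close>; its restriction to
  \<open>asym_centralizer\<close> is the involution written \<open>*\<close>.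
\<close>

definition asymmetry ::
  "('k, 'r) ring_scheme \<Rightarrow> ('k, 'v) module \<Rightarrow> ('v \<Rightarrow> 'v \<Rightarrow> 'k) \<Rightarrow> 'v \<Rightarrow> 'v" where
  "asymmetry K V b = (THE a. a \<in> carrier (end_algebra K V) \<and>
     (\<forall>x\<in>carrier V. \<forall>y\<in>carrier V. b x y = b y (a x)))"

definition adjoint_inv ::
  "('k, 'r) ring_scheme \<Rightarrow> ('k, 'v) module \<Rightarrow> ('v \<Rightarrow> 'v \<Rightarrow> 'k) \<Rightarrow> ('v \<Rightarrow> 'v) \<Rightarrow> 'v \<Rightarrow> 'v" where
  "adjoint_inv K V b f = (THE g. g \<in> carrier (end_algebra K V) \<and>
     (\<forall>x\<in>carrier V. \<forall>y\<in>carrier V. b (f x) y = b x (g y)))"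

definition asym_centralizer ::
  "('k, 'r) ring_scheme \<Rightarrow> ('k, 'v) module \<Rightarrow> ('v \<Rightarrow> 'v \<Rightarrow> 'k) \<Rightarrow> ('k, 'v \<Rightarrow> 'v) module" where
  "asym_centralizer K V b = (end_algebra K V)
     \<lparr>carrier := {f \<in> carrier (end_algebra K V).
        f \<otimes>\<^bsub>end_algebra K V\<^esub> asymmetry K V b = asymmetry K V b \<otimes>\<^bsub>end_algebra K V\<^esub> f}\<rparr>"

definition sym_units ::
  "('k, 'r) ring_scheme \<Rightarrow> ('k, 'v) module \<Rightarrow> ('v \<Rightarrow> 'v \<Rightarrow> 'k) \<Rightarrow> ('v \<Rightarrow> 'v) set" where
  "sym_units K V b = {u \<in> Units (asym_centralizer K V b). adjoint_inv K V b u = u}"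

definition sym_equiv ::
  "('k, 'r) ring_scheme \<Rightarrow> ('k, 'v) module \<Rightarrow> ('v \<Rightarrow> 'v \<Rightarrow> 'k) \<Rightarrow> (('v \<Rightarrow> 'v) \<times> ('v \<Rightarrow> 'v)) set" where
  "sym_equiv K V b = {(u\<^sub>1, u\<^sub>2). u\<^sub>1 \<in> sym_units K V b \<and> u\<^sub>2 \<in> sym_units K V b \<and>
     (\<exists>v \<in> Units (asym_centralizer K V b). \<exists>r \<in> carrier K - {\<zero>\<^bsub>K\<^esub>}.
        u\<^sub>2 = r \<odot>\<^bsub>asym_centralizer K V b\<^esub>
               (v \<otimes>\<^bsub>asym_centralizer K V b\<^esub> u\<^sub>1 \<otimes>\<^bsub>asym_centralizer K V b\<^esub> adjoint_inv K V b v))}"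

definition twisted_form ::
  "('k, 'r) ring_scheme \<Rightarrow> ('k, 'v) module \<Rightarrow> ('v \<Rightarrow> 'v \<Rightarrow> 'k) \<Rightarrow> ('v \<Rightarrow> 'v) \<Rightarrow> 'v \<Rightarrow> 'v \<Rightarrow> 'k" where
  "twisted_form K V b u = (\<lambda>x y. b x ((inv\<^bsub>end_algebra K V\<^esub> u) y))"

definition conjugates_asymmetry ::
  "('k, 'r) ring_scheme \<Rightarrow> ('k, 'v) module \<Rightarrow> ('v \<Rightarrow> 'v \<Rightarrow> 'k) \<Rightarrow>
   ('k, 'w) module \<Rightarrow> ('w \<Rightarrow> 'w \<Rightarrow> 'k) \<Rightarrow> ('v \<Rightarrow> 'w) \<Rightarrow> bool" where
  "conjugates_asymmetry K V b W c f \<longleftrightarrow> linear_iso K V W f \<and>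
     asymmetry K W c = (\<lambda>w\<in>carrier W. f (asymmetry K V b (inv_into (carrier V) f w)))"

definition similar ::
  "('k, 'r) ring_scheme \<Rightarrow> ('k, 'v) module \<times> ('v \<Rightarrow> 'v \<Rightarrow> 'k) \<Rightarrow>
   ('k, 'w) module \<times> ('w \<Rightarrow> 'w \<Rightarrow> 'k) \<Rightarrow> bool" where
  "similar K S T = (case (S, T) of ((V, b), (W, c)) \<Rightarrow>
     \<exists>g. linear_iso K V W g \<and> (\<exists>r \<in> carrier K - {\<zero>\<^bsub>K\<^esub>}.
       \<forall>x\<in>carrier V. \<forall>y\<in>carrier V. c (g x) (g y) = r \<otimes>\<^bsub>K\<^esub> b x y))"

text \<open>
  HOL has no set of all vector spaces, so the type \<open>'w\<close> plays the role of a universe: the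
  spaces \<open>(W, c)\<close> are those whose underlying set is a set of elements of \<open>'w\<close>. Such a universe
  contains a copy of every space isomorphic to \<open>V\<close> as soon as the carrier of \<open>V\<close> injects
  into \<open>'w\<close>.
\<close>

definition conj_spaces ::
  "('k, 'r) ring_scheme \<Rightarrow> ('k, 'v) module \<Rightarrow> ('v \<Rightarrow> 'v \<Rightarrow> 'k) \<Rightarrow>
   (('k, 'w) module \<times> ('w \<Rightarrow> 'w \<Rightarrow> 'k)) set" where
  "conj_spaces K V b = {(W, c). nondegenerate_bilinear_space K W c \<and>
     (\<exists>f. conjugates_asymmetry K V b W c f)}"

definition similarity_rel ::
  "('k, 'r) ring_scheme \<Rightarrow> ('k, 'v) module \<Rightarrow> ('v \<Rightarrow> 'v \<Rightarrow> 'k) \<Rightarrow>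
   ((('k, 'w) module \<times> ('w \<Rightarrow> 'w \<Rightarrow> 'k)) \<times> (('k, 'w) module \<times> ('w \<Rightarrow> 'w \<Rightarrow> 'k))) set" where
  "similarity_rel K V b = {(S, T). S \<in> conj_spaces K V b \<and> T \<in> conj_spaces K V b \<and> similar K S T}"

end

theory Submission
  imports Defs
begin

text \<open>
  Non-degeneracy writes every bilinear form \<open>c\<close> on \<open>V\<close> as \<open>c(x, y) = b(x, w(y))\<close> for a unique
  endomorphism \<open>w\<close>. If \<open>c\<close> has the same asymmetry as \<open>b\<close>, then \<open>w\<close> is self-adjoint, and
  self-adjointness already forces \<open>w\<close> to commute with that asymmetry; hence \<open>c = b\<^sub>u\<close> for
  \<open>u = w\<^sup>-\<^sup>1\<close> in \<open>Sym(C\<^sub>b, *)\<^sup>\<times>\<close>. A similarity \<open>g\<close> from \<open>b\<^sub>1 = b(x, u\<^sub>1\<^sup>-\<^sup>1 y)\<close> to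
  \<open>b\<^sub>2 = b(x, u\<^sub>2\<^sup>-\<^sup>1 y)\<close> with factor \<open>r\<close> means \<open>\<sigma>(g) u\<^sub>2\<^sup>-\<^sup>1 g = r u\<^sub>1\<^sup>-\<^sup>1\<close>, that is
  \<open>u\<^sub>2 = r\<^sup>-\<^sup>1 g u\<^sub>1 \<sigma>(g)\<close>, and \<open>g\<close> commutes with the asymmetry because both forms share it.
\<close>

section \<open>Linear maps and functionals\<close>

lemma linear_mapI:
  assumes "vectorspace K V" "vectorspace K W" "f \<in> carrier V \<rightarrow> carrier W"
    and "\<And>x y. \<lbrakk>x \<in> carrier V; y \<in> carrier V\<rbrakk> \<Longrightarrow> f (x \<oplus>\<^bsub>V\<^esub> y) = f x \<oplus>\<^bsub>W\<^esub> f y"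
    and "\<And>r x. \<lbrakk>r \<in> carrier K; x \<in> carrier V\<rbrakk> \<Longrightarrow> f (r \<odot>\<^bsub>V\<^esub> x) = r \<odot>\<^bsub>W\<^esub> f x"
  shows "linear_map K V W f"
  using assms
  unfolding linear_map_def mod_hom_def mod_hom_axioms_def module_hom_def vectorspace_def by auto

lemma linear_mapD:
  assumes "linear_map K V W f"
  shows linear_map_domain: "vectorspace K V" 
    and linear_map_codomain: "vectorspace K W"
    and linear_map_closed: "x \<in> carrier V \<Longrightarrow> f x \<in> carrier W"
    and linear_map_add: "\<lbrakk>x \<in> carrier V; y \<in> carrier V\<rbrakk> \<Longrightarrow> f (x \<oplus>\<^bsub>V\<^esub> y) = f x \<oplus>\<^bsub>W\<^esub> f y"
    and linear_map_smult: "\<lbrakk>r \<in> carrier K; x \<in> carrier V\<rbrakk> \<Longrightarrow> f (r \<odot>\<^bsub>V\<^esub> x) = r \<odot>\<^bsub>W\<^esub> f x"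
  using assms
  unfolding linear_map_def mod_hom_def mod_hom_axioms_def module_hom_def by auto

lemma linear_map_compose:
  assumes "linear_map K U V f" "linear_map K V W g"
  shows "linear_map K U W (\<lambda>x. g (f x))"
proof -
  interpret f: linear_map K U V f by fact
  interpret g: linear_map K V W g by fact
  show ?thesis
    by (rule linear_mapI) (auto intro: f.V.vectorspace_axioms g.W.vectorspace_axioms)
qed

lemma linear_map_restrict:
  assumes "linear_map K V W f"
  shows "linear_map K V W (restrict f (carrier V))"
proof -
  interpret linear_map K V W f by fact
  show ?thesis
    by (rule linear_mapI) (use assms in \<open>auto dest: linear_mapD\<close>)
qed

lemma linear_map_id:
  assumes "vectorspace K V"
  shows "linear_map K V V (\<lambda>x. x)"
  using assms by (intro linear_mapI) auto

lemma linear_isoD: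
  assumes "linear_iso K V W f"
  shows "linear_map K V W f" "bij_betw f (carrier V) (carrier W)"
  using assms by (auto simp: linear_iso_def)

lemma linear_iso_inv:
  assumes "linear_iso K V W f"
  shows "linear_iso K W V (inv_into (carrier V) f)"
proof -
  interpret linear_map K V W f using assms by (rule linear_isoD)
  have bij: "bij_betw f (carrier V) (carrier W)" using assms by (rule linear_isoD)
  then have inj: "inj_on f (carrier V)" and surj: "f ` carrier V = carrier W"
    by (auto simp: bij_betw_def)
  let ?g = "inv_into (carrier V) f"
  have g: "?g w \<in> carrier V" "f (?g w) = w" if "w \<in> carrier W" for w
    using that surj by (auto intro: inv_into_into f_inv_into_f)
  have eqI: "?g w = x" if "x \<in> carrier V" "f x = w" for x w
    using that inj by auto
  have "linear_map K W V ?g"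
    by (rule linear_mapI) (auto intro!: eqI V.vectorspace_axioms W.vectorspace_axioms simp: g)
  then show ?thesis using bij_betw_inv_into[OF bij] by (simp add: linear_iso_def)
qed

lemma linear_iso_compose:
  assumes "linear_iso K U V f" "linear_iso K V W g"
  shows "linear_iso K U W (\<lambda>x. g (f x))"
  using assms linear_map_compose bij_betw_trans[of f "carrier U" "carrier V" g "carrier W"]
  by (fastforce simp: linear_iso_def comp_def)

lemma linear_iso_fin_dim:
  assumes "linear_iso K V W f" "vectorspace.fin_dim K V"
  shows "vectorspace.fin_dim K W"
proof -
  interpret linear_map K V W f using assms(1) by (rule linear_isoD)
  show ?thesis
    using surj_fin_dim assms by (simp add: linear_iso_def bij_betw_def)
qed

text \<open>An injective linear map sends a basis to an independent set of the same size. In finite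
  dimension this is again a basis, so the image contains a spanning set.\<close>

lemma (in vectorspace) linear_endo_inj_imp_surj:
  assumes "fin_dim" "linear_map K V V f" "inj_on f (carrier V)"
  shows "f ` carrier V = carrier V"
proof -
  interpret f: linear_map K V V f by fact
  obtain B where fin: "finite B" and B: "basis B"
    using finite_basis_exists[OF \<open>fin_dim\<close>] by blast
  then have BV: "B \<subseteq> carrier V" and li: "lin_indpt B" by (auto simp: basis_def)
  have injB: "inj_on f B" using assms(3) BV inj_on_subset by blast
  have fBV: "f ` B \<subseteq> carrier V" using BV by auto
  have "lin_indpt (f ` B)"
  proof (rule finite_lin_indpt2)
    fix c assume c: "c \<in> f ` B \<rightarrow> carrier K" "lincomb c (f ` B) = \<zero>\<^bsub>V\<^esub>"
    \<comment> \<open>By injectivity of \<open>f\<close>, a relation with coefficients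
      \<open>c\<close> on the image of \<open>B\<close> is the image under \<open>f\<close> of the
      relation with coefficients \<open>c \<circ> f\<close> on \<open>B\<close>.\<close>
    have cf: "c \<circ> f \<in> B \<rightarrow> carrier K" using c(1) by auto
    have "f (lincomb (c \<circ> f) B) = f \<zero>\<^bsub>V\<^esub>"
      using f.lincomb_linear_image[OF assms(3) BV c(1) fin] c(2) f.f0_is_0 by metis
    then have "lincomb (c \<circ> f) B = \<zero>\<^bsub>V\<^esub>"
      using inj_onD[OF assms(3)] lincomb_closed[OF BV cf] M.zero_closed by metis
    then have "c \<circ> f \<in> B \<rightarrow> {\<zero>\<^bsub>K\<^esub>}"
      using not_lindepD[OF li fin subset_refl cf] by blast
    then show "\<forall>v\<in>f ` B. c v = \<zero>\<^bsub>K\<^esub>" by auto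
  qed (use fin fBV in auto)
  then have "basis (f ` B)"
    using dim_li_is_basis[OF \<open>fin_dim\<close>, of "f ` B"] fin fBV card_image[OF injB] dim_basis[OF fin B]
    by auto
  then have "carrier V = span (f ` B)" by (simp add: basis_def)
  also have "\<dots> \<subseteq> f.im"
    using BV by (intro span_is_subset f.im_is_submodule) (auto simp: f.im_def)
  finally show ?thesis by (auto simp: f.im_def)
qed

text \<open>Stated for functions into \<open>carrier K\<close>, so that \<open>K\<close> does not
  have to be packaged as a module over itself.\<close>

definition linear_functional where
  "linear_functional K V \<phi> \<longleftrightarrow> \<phi> \<in> carrier V \<rightarrow> carrier K \<and>
     (\<forall>x\<in>carrier V. \<forall>y\<in>carrier V. \<phi> (x \<oplus>\<^bsub>V\<^esub> y) = \<phi> x \<oplus>\<^bsub>K\<^esub> \<phi> y) \<and>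
     (\<forall>r\<in>carrier K. \<forall>x\<in>carrier V. \<phi> (r \<odot>\<^bsub>V\<^esub> x) = r \<otimes>\<^bsub>K\<^esub> \<phi> x)"

text \<open>The points at which two functionals agree form a submodule, so agreement on a generating
  set spreads to its span.\<close>

lemma (in vectorspace) linear_functional_eqI:
  assumes \<phi>: "linear_functional K V \<phi>" and \<psi>: "linear_functional K V \<psi>"
    and B: "B \<subseteq> carrier V" "gen_set B" "\<And>v. v \<in> B \<Longrightarrow> \<phi> v = \<psi> v"
    and x: "x \<in> carrier V"
  shows "\<phi> x = \<psi> x"
proof -
  have zero: "\<chi> \<zero>\<^bsub>V\<^esub> = \<zero>\<^bsub>K\<^esub>" if "linear_functional K V \<chi>" for \<chi>
  proof -
    have "\<chi> (\<zero>\<^bsub>K\<^esub> \<odot>\<^bsub>V\<^esub> \<zero>\<^bsub>V\<^esub>) = \<zero>\<^bsub>K\<^esub> \<otimes>\<^bsub>K\<^esub> \<chi> \<zero>\<^bsub>V\<^esub>"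
      using that R.zero_closed M.zero_closed unfolding linear_functional_def by blast
    moreover have "\<chi> \<zero>\<^bsub>V\<^esub> \<in> carrier K"
      using that M.zero_closed unfolding linear_functional_def by blast
    ultimately show ?thesis by simp
  qed
  let ?E = "{x \<in> carrier V. \<phi> x = \<psi> x}"
  have "submodule K ?E V"
  proof (rule submodule.intro)
    show "module K V" ..
    show "x \<oplus>\<^bsub>V\<^esub> y \<in> ?E" if "x \<in> ?E" "y \<in> ?E" for x y
      using that \<phi> \<psi> by (simp add: linear_functional_def)
    show "r \<odot>\<^bsub>V\<^esub> x \<in> ?E" if "r \<in> carrier K" "x \<in> ?E" for r x
      using that \<phi> \<psi> by (simp add: linear_functional_def)
  qed (use zero[OF \<phi>] zero[OF \<psi>] in auto)
  then have "span B \<subseteq> ?E" using B by (intro span_is_subset) auto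
  then show ?thesis using B x by auto
qed

section \<open>Pullbacks of bilinear forms and representation of functionals\<close>

context bilinear_space
begin

lemma linear_functional_form_left: "y \<in> carrier V \<Longrightarrow> linear_functional K V (\<lambda>x. b x y)"
  by (simp add: linear_functional_def form_closed form_add_left form_smult_left)

lemma bilinear_space_flip: "bilinear_space K V (\<lambda>x y. b y x)"
  by unfold_locales
    (auto simp: finite_dimensional form_closed form_add_left form_smult_left
       form_add_right form_smult_right)

text \<open>Allowing a different map in each argument covers the form \<open>b (f x) y\<close>
  behind adjoints and, through \<open>nondegenerate_pullback\<close>, both twisted forms and forms
  carried along an isomorphism.\<close>

lemma bilinear_space_pullback:
  assumes "linear_map K U V f" "linear_map K U V g" "vectorspace.fin_dim K U"
  shows "bilinear_space K U (\<lambda>x y. b (f x) (g y))"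
proof -
  interpret f: linear_map K U V f by fact
  interpret g: linear_map K U V g by fact
  show ?thesis
    by unfold_locales
      (use assms in \<open>auto simp: form_closed form_add_left form_smult_left
         form_add_right form_smult_right\<close>)
qed

end

context nondegenerate_bilinear_space
begin

lemma right_cancel:
  assumes "y \<in> carrier V" "y' \<in> carrier V" "\<And>x. x \<in> carrier V \<Longrightarrow> b x y = b x y'"
  shows "y = y'"
proof -
  \<comment> \<open>The difference \<open>y - y'\<close> is written with the scalar
    \<open>-1\<close>, since the axioms of a form speak of sums and scalar multiples only.\<close>
  let ?m = "\<ominus>\<^bsub>K\<^esub> \<one>\<^bsub>K\<^esub> \<odot>\<^bsub>V\<^esub> y'"
  have m: "?m = \<ominus>\<^bsub>V\<^esub> y'" using assms(2) by (simp add: smult_minus_1)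
  have "b x (y \<oplus>\<^bsub>V\<^esub> ?m) = \<zero>\<^bsub>K\<^esub>" if "x \<in> carrier V" for x
    using that assms
    by (simp add: form_add_right form_smult_right form_closed l_minus R.r_neg)
  then have "y \<oplus>\<^bsub>V\<^esub> ?m = \<zero>\<^bsub>V\<^esub>"
    using assms by (intro right_nondegenerate) auto
  then show ?thesis using assms by (simp add: m minus_eq[symmetric])
qed

text \<open>
  For a basis \<open>B\<close>, the map \<open>y \<mapsto> \<Sum>v\<in>B. b v y \<cdot> v\<close> is an injective, hence surjective,
  endomorphism of \<open>V\<close>; this avoids the dual space.
\<close>

lemma linear_functional_representation:
  assumes \<phi>: "linear_functional K V \<phi>"
  shows "\<exists>y\<in>carrier V. \<forall>x\<in>carrier V. \<phi> x = b x y"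
proof -
  obtain B where fin: "finite B" and B: "basis B"
    using finite_basis_exists[OF finite_dimensional] by blast
  then have BV: "B \<subseteq> carrier V" and gen: "gen_set B" by (auto simp: basis_def)
  \<comment> \<open>Coordinates in a basis are unique. \<open>basis_criterion\<close> says so for
    extensional coefficient functions, hence the restrictions to \<open>B\<close>.\<close>
  have coeffs: "c v = d v" if "lincomb c B = lincomb d B" "c \<in> B \<rightarrow> carrier K" "d \<in> B \<rightarrow> carrier K"
    "v \<in> B" for c d v
  proof -
    have "lincomb (restrict c B) B = lincomb c B" "lincomb (restrict d B) B = lincomb d B"
      by (rule lincomb_cong[OF refl BV]; use that in simp)+
    moreover have "\<exists>!a. a \<in> B \<rightarrow>\<^sub>E carrier K \<and> lincomb a B = lincomb c B"
      using B basis_criterion[OF fin BV] lincomb_closed[OF BV that(2)] by blast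
    moreover have "restrict c B \<in> B \<rightarrow>\<^sub>E carrier K" "restrict d B \<in> B \<rightarrow>\<^sub>E carrier K"
      using that by auto
    ultimately have "restrict c B = restrict d B" using that(1) by metis
    then show ?thesis using \<open>v \<in> B\<close> by (metis restrict_apply')
  qed
  define T where "T y = lincomb (\<lambda>v. b v y) B" for y
  have bB: "(\<lambda>v. b v y) \<in> B \<rightarrow> carrier K" if "y \<in> carrier V" for y
    using that BV by (auto intro: form_closed)
  have "linear_map K V V T"
  proof (rule linear_mapI)
    show "T \<in> carrier V \<rightarrow> carrier V" using bB BV by (auto simp: T_def)
    show "T (x \<oplus>\<^bsub>V\<^esub> y) = T x \<oplus>\<^bsub>V\<^esub> T y" if "x \<in> carrier V" "y \<in> carrier V" for x y
    proof -
      have "T (x \<oplus>\<^bsub>V\<^esub> y) = lincomb (\<lambda>v. b v x \<oplus>\<^bsub>K\<^esub> b v y) B"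
        unfolding T_def using that BV
        by (intro lincomb_cong) (auto simp: form_add_right subset_eq intro!: form_closed)
      also have "\<dots> = T x \<oplus>\<^bsub>V\<^esub> T y"
        unfolding T_def using that bB by (intro lincomb_sum fin BV) auto
      finally show ?thesis .
    qed
    show "T (r \<odot>\<^bsub>V\<^esub> x) = r \<odot>\<^bsub>V\<^esub> T x" if "r \<in> carrier K" "x \<in> carrier V" for r x
    proof -
      have "T (r \<odot>\<^bsub>V\<^esub> x) = lincomb (\<lambda>v. r \<otimes>\<^bsub>K\<^esub> b v x) B"
        unfolding T_def using that BV
        by (intro lincomb_cong) (auto simp: form_smult_right subset_eq intro!: form_closed)
      also have "\<dots> = r \<odot>\<^bsub>V\<^esub> T x"
        unfolding T_def using that bB by (intro lincomb_smult BV) auto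
      finally show ?thesis .
    qed
  qed (rule vectorspace_axioms)+
  moreover have "inj_on T (carrier V)"
  proof (rule inj_onI)
    fix y y' assume y: "y \<in> carrier V" "y' \<in> carrier V" "T y = T y'"
    have "b v y = b v y'" if "v \<in> B" for v
      using y that by (intro coeffs[of "\<lambda>v. b v y" "\<lambda>v. b v y'"] bB) (simp_all only: T_def)
    then show "y = y'"
      using y linear_functional_eqI[OF linear_functional_form_left[OF y(1)]
          linear_functional_form_left[OF y(2)] BV gen]
      by (intro right_cancel) blast+
  qed
  ultimately have surj: "T ` carrier V = carrier V"
    by (rule linear_endo_inj_imp_surj[OF finite_dimensional])
  \<comment> \<open>The vector with coordinates \<open>\<phi> v\<close> equals \<open>T y\<close>
    for some \<open>y\<close>. Comparing coordinates, \<open>\<phi>\<close> and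
    \<open>\<lambda>x. b x y\<close> agree on \<open>B\<close>, hence everywhere.\<close>
  have \<phi>B: "\<phi> \<in> B \<rightarrow> carrier K" using \<phi> BV by (auto simp: linear_functional_def)
  then have "lincomb \<phi> B \<in> carrier V" using BV by (intro lincomb_closed)
  then obtain y where y: "y \<in> carrier V" "lincomb \<phi> B = T y"
    using surj by (metis imageE)
  have "\<phi> v = b v y" if "v \<in> B" for v
    using y that by (intro coeffs[of \<phi> "\<lambda>v. b v y"] \<phi>B bB) (simp_all only: T_def)
  then show ?thesis
    using linear_functional_eqI[OF \<phi> linear_functional_form_left BV gen] y by blast
qed

end

section \<open>Endomorphisms, asymmetry and adjoints\<close>

lemma mem_end_algebra:
  "f \<in> carrier (end_algebra K V) \<longleftrightarrow> linear_map K V V f \<and> f \<in> extensional (carrier V)"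
  by (simp add: end_algebra_def)

lemma end_algebra_sel:
  "f \<otimes>\<^bsub>end_algebra K V\<^esub> g = compose (carrier V) f g"
  "\<one>\<^bsub>end_algebra K V\<^esub> = (\<lambda>x\<in>carrier V. x)"
  "r \<odot>\<^bsub>end_algebra K V\<^esub> f = (\<lambda>x\<in>carrier V. r \<odot>\<^bsub>V\<^esub> f x)"
  by (simp_all add: end_algebra_def)

lemma end_algebra_closed:
  "\<lbrakk>f \<in> carrier (end_algebra K V); x \<in> carrier V\<rbrakk> \<Longrightarrow> f x \<in> carrier V"
  using linear_map_closed[of K V V f x] by (simp add: mem_end_algebra)

lemma end_algebra_eqI:
  assumes "f \<in> carrier (end_algebra K V)" "g \<in> carrier (end_algebra K V)"
    and "\<And>x. x \<in> carrier V \<Longrightarrow> f x = g x"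
  shows "f = g"
  using assms by (intro extensionalityI[of f "carrier V" g]) (auto simp: mem_end_algebra)

lemma end_algebra_restrict:
  "linear_map K V V f \<Longrightarrow> restrict f (carrier V) \<in> carrier (end_algebra K V)"
  by (simp add: mem_end_algebra linear_map_restrict)

lemma end_algebra_compose:
  assumes "f \<in> carrier (end_algebra K V)" "g \<in> carrier (end_algebra K V)"
  shows "compose (carrier V) f g \<in> carrier (end_algebra K V)"
  unfolding compose_def
  by (rule end_algebra_restrict, rule linear_map_compose[where V = V])
    (use assms in \<open>simp_all add: mem_end_algebra\<close>)

lemma (in vectorspace) smult_smult_commute:
  assumes "r \<in> carrier K" "s \<in> carrier K" "x \<in> carrier V"
  shows "r \<odot>\<^bsub>V\<^esub> (s \<odot>\<^bsub>V\<^esub> x) = s \<odot>\<^bsub>V\<^esub> (r \<odot>\<^bsub>V\<^esub> x)"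
proof -
  have "r \<odot>\<^bsub>V\<^esub> (s \<odot>\<^bsub>V\<^esub> x) = (r \<otimes>\<^bsub>K\<^esub> s) \<odot>\<^bsub>V\<^esub> x"
    using assms by (rule smult_assoc1[symmetric])
  also have "r \<otimes>\<^bsub>K\<^esub> s = s \<otimes>\<^bsub>K\<^esub> r"
    using assms(1,2) by (rule R.m_comm)
  also have "\<dots> \<odot>\<^bsub>V\<^esub> x = s \<odot>\<^bsub>V\<^esub> (r \<odot>\<^bsub>V\<^esub> x)"
    using assms(2,1,3) by (rule smult_assoc1)
  finally show ?thesis .
qed

lemma end_algebra_smult:
  assumes "r \<in> carrier K" "f \<in> carrier (end_algebra K V)"
  shows "r \<odot>\<^bsub>end_algebra K V\<^esub> f \<in> carrier (end_algebra K V)"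
proof -
  interpret f: linear_map K V V f using assms by (simp add: mem_end_algebra)
  have "linear_map K V V (\<lambda>x. r \<odot>\<^bsub>V\<^esub> f x)"
    by (rule linear_mapI)
      (simp_all add: assms f.V.vectorspace_axioms f.V.module.smult_r_distr
        f.V.smult_smult_commute[of r])
  then show ?thesis by (simp add: end_algebra_sel end_algebra_restrict)
qed

lemma monoid_end_algebra:
  assumes "vectorspace K V"
  shows "monoid (end_algebra K V)"
proof (rule monoidI; unfold end_algebra_sel)
  have id: "(\<lambda>x\<in>carrier V. x) \<in> carrier (end_algebra K V)"
    using assms by (intro end_algebra_restrict linear_map_id)
  then show "(\<lambda>x\<in>carrier V. x) \<in> carrier (end_algebra K V)" .
  fix f g h
  assume f: "f \<in> carrier (end_algebra K V)"
  show "compose (carrier V) (\<lambda>x\<in>carrier V. x) f = f"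
    by (rule end_algebra_eqI[where K = K and V = V]; simp add: f id end_algebra_compose end_algebra_closed[OF f] compose_eq)
  show "compose (carrier V) f (\<lambda>x\<in>carrier V. x) = f"
    by (rule end_algebra_eqI[where K = K and V = V]; simp add: f id end_algebra_compose end_algebra_closed[OF f] compose_eq)
  assume g: "g \<in> carrier (end_algebra K V)"
  show "compose (carrier V) f g \<in> carrier (end_algebra K V)"
    using f g by (rule end_algebra_compose)
  assume h: "h \<in> carrier (end_algebra K V)"
  show "compose (carrier V) (compose (carrier V) f g) h =
      compose (carrier V) f (compose (carrier V) g h)"
    by (rule end_algebra_eqI[where K = K and V = V]; simp add: f g h end_algebra_compose end_algebra_closed[OF h] compose_eq)
qed

lemma end_algebra_unit_inv:
  assumes "vectorspace K V" "u \<in> Units (end_algebra K V)" "x \<in> carrier V"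
  shows end_algebra_unit_inv_left: "(inv\<^bsub>end_algebra K V\<^esub> u) (u x) = x"
    and end_algebra_unit_inv_right: "u ((inv\<^bsub>end_algebra K V\<^esub> u) x) = x"
proof -
  interpret monoid "end_algebra K V" using assms(1) by (rule monoid_end_algebra)
  have "(inv\<^bsub>end_algebra K V\<^esub> u \<otimes>\<^bsub>end_algebra K V\<^esub> u) x = x"
    "(u \<otimes>\<^bsub>end_algebra K V\<^esub> inv\<^bsub>end_algebra K V\<^esub> u) x = x"
    using assms by (simp_all add: Units_l_inv Units_r_inv end_algebra_sel(2))
  then show "(inv\<^bsub>end_algebra K V\<^esub> u) (u x) = x" "u ((inv\<^bsub>end_algebra K V\<^esub> u) x) = x"
    using assms(3) by (simp_all add: end_algebra_sel(1) compose_eq)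
qed

text \<open>Lets units of the endomorphism algebra be handled as linear bijections, to which the
  results on pullbacks apply.\<close>

lemma Units_end_algebra_iff_linear_iso:
  assumes "vectorspace K V"
  shows "u \<in> Units (end_algebra K V) \<longleftrightarrow> linear_iso K V V u \<and> u \<in> extensional (carrier V)"
proof -
  interpret monoid "end_algebra K V" using assms by (rule monoid_end_algebra)
  show ?thesis
  proof (intro iffI)
    assume u: "u \<in> Units (end_algebra K V)"
    then have "u \<in> carrier (end_algebra K V)" "inv\<^bsub>end_algebra K V\<^esub> u \<in> carrier (end_algebra K V)"
      by auto
    moreover have "bij_betw u (carrier V) (carrier V)"
      using calculation end_algebra_unit_inv[OF assms u]
      by (intro bij_betwI[where g = "inv\<^bsub>end_algebra K V\<^esub> u"]) (auto simp: end_algebra_closed)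
    ultimately show "linear_iso K V V u \<and> u \<in> extensional (carrier V)"
      by (simp add: linear_iso_def mem_end_algebra)
  next
    assume u: "linear_iso K V V u \<and> u \<in> extensional (carrier V)"
    \<comment> \<open>The set-theoretic inverse is linear by \<open>linear_iso_inv\<close>;
      restricting it makes it extensional, as membership in the algebra demands.\<close>
    define w where "w = restrict (inv_into (carrier V) u) (carrier V)"
    have bij: "bij_betw u (carrier V) (carrier V)" using u by (simp add: linear_iso_def)
    have uE: "u \<in> carrier (end_algebra K V)"
      using u by (simp add: linear_iso_def mem_end_algebra)
    have wE: "w \<in> carrier (end_algebra K V)"
      using u linear_iso_inv[of K V V u]
      by (simp add: w_def linear_iso_def end_algebra_restrict)
    have "compose (carrier V) u w = (\<lambda>x\<in>carrier V. x)" "compose (carrier V) w u = (\<lambda>x\<in>carrier V. x)"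
      using bij bij_betw_inv_into_left[OF bij] bij_betw_inv_into_right[OF bij]
      by (auto simp: compose_def w_def fun_eq_iff bij_betw_def)
    then show "u \<in> Units (end_algebra K V)"
      using uE wE by (auto simp: Units_def end_algebra_sel)
  qed
qed

text \<open>Adds no assumption. It pins \<open>V\<close> to the plain \<open>module\<close> record
  type that \<open>end_algebra\<close>, \<open>asymmetry\<close> and \<open>adjoint_inv\<close> take
  as argument.\<close>

locale nondegenerate_space = nondegenerate_bilinear_space K V b
  for K :: "('k, 'r) ring_scheme" (structure) and V :: "('k, 'v) module" (structure) and b
begin

abbreviation "E \<equiv> end_algebra K V"
abbreviation "\<alpha> \<equiv> asymmetry K V b"
abbreviation "adj \<equiv> adjoint_inv K V b"

sublocale End: monoid E
  using monoid_end_algebra vectorspace_axioms .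

lemma form_eqI:
  assumes "f \<in> carrier E" "g \<in> carrier E"
    and "\<And>x y. \<lbrakk>x \<in> carrier V; y \<in> carrier V\<rbrakk> \<Longrightarrow> b x (f y) = b x (g y)"
  shows "f = g"
proof (rule end_algebra_eqI[OF assms(1,2)])
  fix y assume y: "y \<in> carrier V"
  show "f y = g y"
    by (rule right_cancel) (use assms(3) y end_algebra_closed[OF assms(1) y] end_algebra_closed[OF assms(2) y] in blast)+
qed

text \<open>For fixed \<open>y\<close> the functional \<open>\<lambda>x. c x y\<close> is
  represented by a vector \<open>g y\<close>, and cancellation in the right argument of
  \<open>b\<close> makes \<open>g\<close> linear and unique. The asymmetry, the adjoints and the
  units \<open>u\<close> of the correspondence all arise in this way.\<close>

lemma form_representation:
  assumes "bilinear_space K V c"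
  shows "\<exists>!g. g \<in> carrier E \<and> (\<forall>x\<in>carrier V. \<forall>y\<in>carrier V. c x y = b x (g y))"
proof (rule ex_ex1I)
  interpret c: bilinear_space K V c by fact
  have "\<forall>y\<in>carrier V. \<exists>z\<in>carrier V. \<forall>x\<in>carrier V. c x y = b x z"
    using linear_functional_representation[OF c.linear_functional_form_left] by blast
  then obtain g where g: "\<And>y. y \<in> carrier V \<Longrightarrow> g y \<in> carrier V"
    "\<And>x y. \<lbrakk>x \<in> carrier V; y \<in> carrier V\<rbrakk> \<Longrightarrow> b x (g y) = c x y"
    by metis
  have "linear_map K V V g"
    by (rule linear_mapI)
      (auto intro!: vectorspace_axioms right_cancel
         simp: g form_add_right form_smult_right c.form_add_right c.form_smult_right)
  then show "\<exists>g. g \<in> carrier E \<and> (\<forall>x\<in>carrier V. \<forall>y\<in>carrier V. c x y = b x (g y))"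
    using g by (intro exI[of _ "restrict g (carrier V)"]) (simp add: end_algebra_restrict)
next
  fix f g
  assume "f \<in> carrier E \<and> (\<forall>x\<in>carrier V. \<forall>y\<in>carrier V. c x y = b x (f y))"
    "g \<in> carrier E \<and> (\<forall>x\<in>carrier V. \<forall>y\<in>carrier V. c x y = b x (g y))"
  then show "f = g" by (intro form_eqI) metis+
qed

lemma asymmetry:
  shows asymmetry_closed: "\<alpha> \<in> carrier E"
    and form_asymmetry: "\<lbrakk>x \<in> carrier V; y \<in> carrier V\<rbrakk> \<Longrightarrow> b y (\<alpha> x) = b x y"
proof -
  \<comment> \<open>Representing the flipped form gives the defining equation of the asymmetry with
    the two quantified variables exchanged.\<close>
  have "(\<forall>x\<in>carrier V. \<forall>y\<in>carrier V. b y x = b x (g y)) \<longleftrightarrow>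
      (\<forall>x\<in>carrier V. \<forall>y\<in>carrier V. b x y = b y (g x))" for g
    by blast
  then have "\<exists>!g. g \<in> carrier E \<and> (\<forall>x\<in>carrier V. \<forall>y\<in>carrier V. b x y = b y (g x))"
    using form_representation[OF bilinear_space_flip] by simp
  from theI'[OF this, folded asymmetry_def]
  show "\<alpha> \<in> carrier E" "\<lbrakk>x \<in> carrier V; y \<in> carrier V\<rbrakk> \<Longrightarrow> b y (\<alpha> x) = b x y"
    by simp_all
qed

lemma asymmetry_eqI:
  assumes "g \<in> carrier E" "\<And>x y. \<lbrakk>x \<in> carrier V; y \<in> carrier V\<rbrakk> \<Longrightarrow> b y (g x) = b x y"
  shows "\<alpha> = g"
  using assms by (intro form_eqI asymmetry_closed) (auto simp: form_asymmetry)

text \<open>If \<open>\<alpha> x = \<alpha> y\<close>, then \<open>x\<close> and \<open>y\<close>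
  pair equally from the left, so they coincide by cancellation for the flipped form; finite
  dimension then gives surjectivity. It allows an argument of \<open>b\<close> to be written as
  \<open>\<alpha> z\<close>.\<close>

lemma asymmetry_surj: "\<alpha> ` carrier V = carrier V"
proof (rule linear_endo_inj_imp_surj[OF finite_dimensional])
  show "linear_map K V V \<alpha>" using asymmetry_closed by (simp add: mem_end_algebra)
  show "inj_on \<alpha> (carrier V)"
  proof (rule inj_onI)
    interpret flip: nondegenerate_bilinear_space K V "\<lambda>x y. b y x"
      by (intro nondegenerate_bilinear_space.intro bilinear_space_flip
          nondegenerate_bilinear_space_axioms.intro)
        (auto intro: left_nondegenerate right_nondegenerate)
    fix x y assume "x \<in> carrier V" "y \<in> carrier V" "\<alpha> x = \<alpha> y"
    then show "x = y" by (metis flip.right_cancel form_asymmetry)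
  qed
qed

text \<open>The adjoint represents the form \<open>b (f x) y\<close>, which justifies the definite
  description in \<open>adjoint_inv\<close>.\<close>

lemma adjoint:
  assumes "f \<in> carrier E"
  shows adjoint_closed: "adj f \<in> carrier E"
    and form_adjoint: "\<lbrakk>x \<in> carrier V; y \<in> carrier V\<rbrakk> \<Longrightarrow> b x (adj f y) = b (f x) y"
proof -
  have "bilinear_space K V (\<lambda>x y. b (f x) y)"
    using assms by (intro bilinear_space_pullback linear_map_id vectorspace_axioms finite_dimensional)
      (simp add: mem_end_algebra)
  then have "\<exists>!g. g \<in> carrier E \<and> (\<forall>x\<in>carrier V. \<forall>y\<in>carrier V. b (f x) y = b x (g y))"
    by (rule form_representation)
  from theI'[OF this, folded adjoint_inv_def]
  show "adj f \<in> carrier E" "\<lbrakk>x \<in> carrier V; y \<in> carrier V\<rbrakk> \<Longrightarrow> b x (adj f y) = b (f x) y"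
    by simp_all
qed

text \<open>A form of \<open>adj f = f\<close> free of the definite description; the two agree on
  \<open>carrier E\<close>.\<close>

definition self_adjoint where
  "self_adjoint f \<longleftrightarrow> (\<forall>x\<in>carrier V. \<forall>y\<in>carrier V. b (f x) y = b x (f y))"

lemma adjoint_eq_self_iff: "f \<in> carrier E \<Longrightarrow> adj f = f \<longleftrightarrow> self_adjoint f"
proof (intro iffI)
  assume f: "f \<in> carrier E" and "adj f = f"
  then show "self_adjoint f" using form_adjoint[OF f] by (simp add: self_adjoint_def)
next
  assume f: "f \<in> carrier E" and "self_adjoint f"
  then show "adj f = f"
    using adjoint_closed[OF f] form_adjoint[OF f] by (intro form_eqI) (simp_all add: self_adjoint_def)
qed

text \<open>\<open>b (y, f a x) = b (f y, a x) = b (x, f y) = b (f x, y) = b (y, a f x)\<close>\<close>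

lemma self_adjoint_asymmetry_commute:
  assumes "f \<in> carrier E" "self_adjoint f" "x \<in> carrier V"
  shows "f (\<alpha> x) = \<alpha> (f x)"
proof (rule right_cancel)
  have fx: "f x \<in> carrier V" and ax: "\<alpha> x \<in> carrier V"
    using assms asymmetry_closed by (auto intro: end_algebra_closed)
  show "f (\<alpha> x) \<in> carrier V" "\<alpha> (f x) \<in> carrier V"
    using assms asymmetry_closed fx ax by (auto intro: end_algebra_closed)
  fix y assume y: "y \<in> carrier V"
  have fy: "f y \<in> carrier V" using assms y by (auto intro: end_algebra_closed)
  have "b y (f (\<alpha> x)) = b (f y) (\<alpha> x)" using assms(2) y ax by (simp add: self_adjoint_def)
  also have "\<dots> = b x (f y)" using assms(3) fy by (rule form_asymmetry)
  also have "\<dots> = b (f x) y" using assms(2,3) y by (simp add: self_adjoint_def)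
  also have "\<dots> = b y (\<alpha> (f x))" using fx y by (simp add: form_asymmetry)
  finally show "b y (f (\<alpha> x)) = b y (\<alpha> (f x))" .
qed

section \<open>The centralizer of the asymmetry and its symmetric units\<close>

lemma mem_asym_centralizer:
  "f \<in> carrier (asym_centralizer K V b) \<longleftrightarrow>
     f \<in> carrier E \<and> (\<forall>x\<in>carrier V. f (\<alpha> x) = \<alpha> (f x))"
proof -
  have "compose (carrier V) f \<alpha> = compose (carrier V) \<alpha> f \<longleftrightarrow>
      (\<forall>x\<in>carrier V. f (\<alpha> x) = \<alpha> (f x))"
    by (auto simp: compose_def dest: fun_cong intro: restrict_ext split: if_splits)
  then show ?thesis by (simp add: asym_centralizer_def end_algebra_sel)
qed

lemma asym_centralizer_sel:
  "mult (asym_centralizer K V b) = mult E" "one (asym_centralizer K V b) = one E"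
  "smult (asym_centralizer K V b) = smult E"
  by (simp_all add: asym_centralizer_def)

text \<open>If \<open>u\<close> commutes with \<open>\<alpha>\<close>, so does its inverse in
  \<open>E\<close>: insert \<open>u\<close> after its inverse and move it past
  \<open>\<alpha>\<close>. Hence inverses taken in \<open>E\<close> and in the centralizer
  coincide.\<close>

lemma Units_asym_centralizer:
  "u \<in> Units (asym_centralizer K V b) \<longleftrightarrow>
     u \<in> Units E \<and> (\<forall>x\<in>carrier V. u (\<alpha> x) = \<alpha> (u x))"
proof (intro iffI)
  assume "u \<in> Units (asym_centralizer K V b)"
  then show "u \<in> Units E \<and> (\<forall>x\<in>carrier V. u (\<alpha> x) = \<alpha> (u x))"
    unfolding Units_def by (auto simp: mem_asym_centralizer asym_centralizer_sel)
next
  assume u: "u \<in> Units E \<and> (\<forall>x\<in>carrier V. u (\<alpha> x) = \<alpha> (u x))"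
  let ?w = "inv\<^bsub>E\<^esub> u"
  have uE: "u \<in> Units E" and uc: "u \<in> carrier E" "?w \<in> carrier E" using u by auto
  have "?w (\<alpha> x) = \<alpha> (?w x)" if x: "x \<in> carrier V" for x
  proof -
    have wx: "?w x \<in> carrier V" and "\<alpha> (?w x) \<in> carrier V"
      using uc x asymmetry_closed by (auto intro: end_algebra_closed)
    then have "\<alpha> (?w x) = ?w (u (\<alpha> (?w x)))"
      using uE by (simp add: end_algebra_unit_inv_left vectorspace_axioms)
    also have "u (\<alpha> (?w x)) = \<alpha> x"
      using u wx x by (simp add: end_algebra_unit_inv_right vectorspace_axioms)
    finally show ?thesis ..
  qed
  then have "?w \<in> carrier (asym_centralizer K V b)" "u \<in> carrier (asym_centralizer K V b)"
    using u uc by (auto simp: mem_asym_centralizer)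
  then show "u \<in> Units (asym_centralizer K V b)"
    using End.Units_l_inv[OF uE] End.Units_r_inv[OF uE]
    by (auto simp: Units_def asym_centralizer_sel)
qed

text \<open>Commutation with \<open>\<alpha>\<close> follows from self-adjointness by
  \<open>self_adjoint_asymmetry_commute\<close>. From here on symmetric units are treated through
  this description.\<close>

lemma mem_sym_units: "u \<in> sym_units K V b \<longleftrightarrow> u \<in> Units E \<and> self_adjoint u"
  using adjoint_eq_self_iff[of u] self_adjoint_asymmetry_commute[of u]
  by (auto simp: sym_units_def Units_asym_centralizer)

end

section \<open>Pullback and similarity\<close>

lemma (in vectorspace) inv_nonzero:
  assumes "r \<in> carrier K - {\<zero>\<^bsub>K\<^esub>}"
  shows "inv\<^bsub>K\<^esub> r \<in> carrier K - {\<zero>\<^bsub>K\<^esub>}" "r \<otimes>\<^bsub>K\<^esub> inv\<^bsub>K\<^esub> r = \<one>\<^bsub>K\<^esub>" "inv\<^bsub>K\<^esub> r \<otimes>\<^bsub>K\<^esub> r = \<one>\<^bsub>K\<^esub>"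
proof -
  have r: "r \<in> Units K" using assms by (simp add: field_Units)
  show "inv\<^bsub>K\<^esub> r \<in> carrier K - {\<zero>\<^bsub>K\<^esub>}"
    using R.Units_inv_Units[OF r] by (simp add: field_Units)
  show "r \<otimes>\<^bsub>K\<^esub> inv\<^bsub>K\<^esub> r = \<one>\<^bsub>K\<^esub>" "inv\<^bsub>K\<^esub> r \<otimes>\<^bsub>K\<^esub> r = \<one>\<^bsub>K\<^esub>"
    using r by (rule R.Units_r_inv R.Units_l_inv)+
qed

lemma linear_iso_apply:
  assumes "linear_iso K V W f"
  shows linear_iso_closed: "x \<in> carrier V \<Longrightarrow> f x \<in> carrier W"
    and linear_iso_inv_closed: "w \<in> carrier W \<Longrightarrow> inv_into (carrier V) f w \<in> carrier V"
    and linear_iso_inv_left: "x \<in> carrier V \<Longrightarrow> inv_into (carrier V) f (f x) = x"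
    and linear_iso_inv_right: "w \<in> carrier W \<Longrightarrow> f (inv_into (carrier V) f w) = w"
proof -
  have bij: "bij_betw f (carrier V) (carrier W)" using assms by (rule linear_isoD)
  show "x \<in> carrier V \<Longrightarrow> f x \<in> carrier W" using bij by (rule bij_betwE[rule_format])
  show "w \<in> carrier W \<Longrightarrow> inv_into (carrier V) f w \<in> carrier V"
    using bij_betw_inv_into[OF bij] by (rule bij_betwE[rule_format])
  show "x \<in> carrier V \<Longrightarrow> inv_into (carrier V) f (f x) = x"
    using bij by (rule bij_betw_inv_into_left)
  show "w \<in> carrier W \<Longrightarrow> f (inv_into (carrier V) f w) = w"
    using bij by (rule bij_betw_inv_into_right)
qed

lemma linear_iso_id: "vectorspace K V \<Longrightarrow> linear_iso K V V (\<lambda>x. x)"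
  by (simp add: linear_iso_def linear_map_id bij_betw_def inj_on_def)

text \<open>Surjectivity of one map turns vanishing against \<open>U\<close> into vanishing against
  \<open>V\<close>, and injectivity of the other brings the conclusion back to
  \<open>U\<close>.\<close>

lemma (in nondegenerate_bilinear_space) nondegenerate_pullback:
  assumes f: "linear_iso K U V f" and g: "linear_iso K U V g"
  shows "nondegenerate_bilinear_space K U (\<lambda>x y. b (f x) (g y))"
proof -
  interpret f: linear_map K U V f using f by (rule linear_isoD)
  interpret g: linear_map K U V g using g by (rule linear_isoD)
  have fd: "f.V.fin_dim"
    using linear_iso_inv[OF f] finite_dimensional by (rule linear_iso_fin_dim)
  show ?thesis
  proof (intro nondegenerate_bilinear_space.intro nondegenerate_bilinear_space_axioms.intro)
    show "bilinear_space K U (\<lambda>x y. b (f x) (g y))"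
      using linear_isoD(1)[OF f] linear_isoD(1)[OF g] fd by (rule bilinear_space_pullback)
  next
    fix x assume x: "x \<in> carrier U" and *: "\<And>y. y \<in> carrier U \<Longrightarrow> b (f x) (g y) = \<zero>\<^bsub>K\<^esub>"
    have "f x = \<zero>\<^bsub>V\<^esub>"
    proof (rule left_nondegenerate)
      show "b (f x) y = \<zero>\<^bsub>K\<^esub>" if "y \<in> carrier V" for y
        using *[of "inv_into (carrier U) g y"] linear_iso_apply[OF g] that by simp
    qed (use x in simp)
    then show "x = \<zero>\<^bsub>U\<^esub>"
      using linear_iso_inv_left[OF f] x f.T0_is_0 f.V.module.M.zero_closed by metis
  next
    fix y assume y: "y \<in> carrier U" and *: "\<And>x. x \<in> carrier U \<Longrightarrow> b (f x) (g y) = \<zero>\<^bsub>K\<^esub>"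
    have "g y = \<zero>\<^bsub>V\<^esub>"
    proof (rule right_nondegenerate)
      show "b x (g y) = \<zero>\<^bsub>K\<^esub>" if "x \<in> carrier V" for x
        using *[of "inv_into (carrier U) f x"] linear_iso_apply[OF f] that by simp
    qed (use y in simp)
    then show "y = \<zero>\<^bsub>U\<^esub>"
      using linear_iso_inv_left[OF g] y g.T0_is_0 f.V.module.M.zero_closed by metis
  qed
qed

text \<open>Transport of structure: a copy of \<open>V\<close> is built inside the type
  \<open>'w\<close>, which serves as the universe of spaces.\<close>

lemma ex_linear_iso_of_inj_on:
  fixes V :: "('k, 'v) module" and \<iota> :: "'v \<Rightarrow> 'w"
  assumes "vectorspace K V" and inj: "inj_on \<iota> (carrier V)"
  shows "\<exists>W :: ('k, 'w) module. linear_iso K V W \<iota>"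
proof -
  interpret vectorspace K V by fact
  let ?j = "inv_into (carrier V) \<iota>"
  \<comment> \<open>Only zero, addition and scalar multiplication are transported. The fields
    \<open>mult\<close> and \<open>one\<close>, inherited from the ring record, get arbitrary
    values.\<close>
  define W :: "('k, 'w) module" where "W = \<lparr>carrier = \<iota> ` carrier V,
    mult = undefined, one = undefined, zero = \<iota> \<zero>\<^bsub>V\<^esub>,
    add = (\<lambda>x y. \<iota> (?j x \<oplus>\<^bsub>V\<^esub> ?j y)), smult = (\<lambda>r x. \<iota> (r \<odot>\<^bsub>V\<^esub> ?j x))\<rparr>"
  have W: "carrier W = \<iota> ` carrier V" "\<zero>\<^bsub>W\<^esub> = \<iota> \<zero>\<^bsub>V\<^esub>"
    "x \<oplus>\<^bsub>W\<^esub> y = \<iota> (?j x \<oplus>\<^bsub>V\<^esub> ?j y)" "r \<odot>\<^bsub>W\<^esub> x = \<iota> (r \<odot>\<^bsub>V\<^esub> ?j x)" for x y r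
    by (simp_all add: W_def)
  have j: "?j (\<iota> x) = x" if "x \<in> carrier V" for x using inj that by simp
  have "vectorspace K W"
  proof (rule vs_criteria)
    show "field K" ..
    show "\<forall>v\<in>carrier W. \<exists>w\<in>carrier W. v \<oplus>\<^bsub>W\<^esub> w = \<zero>\<^bsub>W\<^esub>"
    proof
      fix v assume "v \<in> carrier W"
      then obtain x where x: "x \<in> carrier V" "v = \<iota> x" by (auto simp: W)
      then have "v \<oplus>\<^bsub>W\<^esub> \<iota> (\<ominus>\<^bsub>V\<^esub> x) = \<zero>\<^bsub>W\<^esub>" by (simp add: W j M.r_neg)
      then show "\<exists>w\<in>carrier W. v \<oplus>\<^bsub>W\<^esub> w = \<zero>\<^bsub>W\<^esub>" using x by (auto simp: W(1))
    qed
  qed (auto simp: W j smult_l_distr smult_r_distr smult_assoc1 M.a_assoc intro: arg_cong[OF M.a_comm])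
  then have "linear_map K V W \<iota>"
    by (intro linear_mapI vectorspace_axioms) (auto simp: W j)
  then show ?thesis using inj by (auto simp: linear_iso_def bij_betw_def W)
qed

section \<open>Similarity is symmetric and transitive\<close>

lemma similarI:
  assumes "linear_iso K V W g" "r \<in> carrier K - {\<zero>\<^bsub>K\<^esub>}"
    and "\<And>x y. \<lbrakk>x \<in> carrier V; y \<in> carrier V\<rbrakk> \<Longrightarrow> c (g x) (g y) = r \<otimes>\<^bsub>K\<^esub> b x y"
  shows "similar K (V, b) (W, c)"
  using assms by (auto simp: similar_def)

lemma similarE:
  assumes "similar K (V, b) (W, c)"
  obtains g r where "linear_iso K V W g" "r \<in> carrier K - {\<zero>\<^bsub>K\<^esub>}"
    "\<And>x y. \<lbrakk>x \<in> carrier V; y \<in> carrier V\<rbrakk> \<Longrightarrow> c (g x) (g y) = r \<otimes>\<^bsub>K\<^esub> b x y"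
  using assms by (auto simp: similar_def)

lemma similar_isometric:
  assumes "bilinear_space K V b" "linear_iso K V W g"
    and "\<And>x y. \<lbrakk>x \<in> carrier V; y \<in> carrier V\<rbrakk> \<Longrightarrow> c (g x) (g y) = b x y"
  shows "similar K (V, b) (W, c)"
proof -
  interpret bilinear_space K V b by fact
  show ?thesis
    using assms(2)
    by (rule similarI[where r = "\<one>\<^bsub>K\<^esub>"]) (use assms(3) in \<open>simp_all add: form_closed\<close>)
qed

lemma similar_sym:
  assumes "bilinear_space K V b" "similar K (V, b) (W, c)"
  shows "similar K (W, c) (V, b)"
  using assms(2)
proof (rule similarE)
  interpret bilinear_space K V b by fact
  fix g r assume g: "linear_iso K V W g" and r: "r \<in> carrier K - {\<zero>\<^bsub>K\<^esub>}"
    and c: "\<And>x y. \<lbrakk>x \<in> carrier V; y \<in> carrier V\<rbrakk> \<Longrightarrow> c (g x) (g y) = r \<otimes>\<^bsub>K\<^esub> b x y"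
  let ?h = "inv_into (carrier V) g"
  show ?thesis
  proof (rule similarI[OF linear_iso_inv[OF g] inv_nonzero(1)[OF r]])
    fix x y assume xy: "x \<in> carrier W" "y \<in> carrier W"
    have h: "?h x \<in> carrier V" "?h y \<in> carrier V" "g (?h x) = x" "g (?h y) = y"
      using xy linear_iso_apply[OF g] by auto
    have "inv\<^bsub>K\<^esub> r \<otimes>\<^bsub>K\<^esub> c x y = inv\<^bsub>K\<^esub> r \<otimes>\<^bsub>K\<^esub> (r \<otimes>\<^bsub>K\<^esub> b (?h x) (?h y))"
      using c[OF h(1,2)] by (simp add: h)
    also have "\<dots> = (inv\<^bsub>K\<^esub> r \<otimes>\<^bsub>K\<^esub> r) \<otimes>\<^bsub>K\<^esub> b (?h x) (?h y)"
      using r inv_nonzero[OF r] h by (subst R.m_assoc) (auto intro: form_closed)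
    also have "\<dots> = b (?h x) (?h y)" using inv_nonzero[OF r] h by (simp add: form_closed)
    finally show "b (?h x) (?h y) = inv\<^bsub>K\<^esub> r \<otimes>\<^bsub>K\<^esub> c x y" ..
  qed
qed

lemma similar_trans:
  assumes "bilinear_space K V b" "similar K (V, b) (W, c)" "similar K (W, c) (X, d)"
  shows "similar K (V, b) (X, d)"
  using assms(2)
proof (rule similarE)
  interpret bilinear_space K V b by fact
  fix g r assume g: "linear_iso K V W g" and r: "r \<in> carrier K - {\<zero>\<^bsub>K\<^esub>}"
    and c: "\<And>x y. \<lbrakk>x \<in> carrier V; y \<in> carrier V\<rbrakk> \<Longrightarrow> c (g x) (g y) = r \<otimes>\<^bsub>K\<^esub> b x y"
  show ?thesis using assms(3)
  proof (rule similarE)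
    fix h s assume h: "linear_iso K W X h" and s: "s \<in> carrier K - {\<zero>\<^bsub>K\<^esub>}"
      and d: "\<And>x y. \<lbrakk>x \<in> carrier W; y \<in> carrier W\<rbrakk> \<Longrightarrow> d (h x) (h y) = s \<otimes>\<^bsub>K\<^esub> c x y"
    show ?thesis
    proof (rule similarI[OF linear_iso_compose[OF g h]])
      show "s \<otimes>\<^bsub>K\<^esub> r \<in> carrier K - {\<zero>\<^bsub>K\<^esub>}" using r s integral by auto
      show "d (h (g x)) (h (g y)) = s \<otimes>\<^bsub>K\<^esub> r \<otimes>\<^bsub>K\<^esub> b x y" if "x \<in> carrier V" "y \<in> carrier V" for x y
        using that r s by (simp add: linear_iso_closed[OF g] d c form_closed R.m_assoc)
    qed
  qed
qed

section \<open>Twisted forms\<close>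

context nondegenerate_space
begin

lemma Units_E_linear_iso: "u \<in> Units E \<Longrightarrow> linear_iso K V V u"
  by (simp add: Units_end_algebra_iff_linear_iso vectorspace_axioms)

lemma unit_apply:
  assumes "u \<in> Units E" "x \<in> carrier V"
  shows unit_closed: "u x \<in> carrier V"
    and unit_inv_closed: "(inv\<^bsub>E\<^esub> u) x \<in> carrier V"
    and unit_inv_left: "(inv\<^bsub>E\<^esub> u) (u x) = x"
    and unit_inv_right: "u ((inv\<^bsub>E\<^esub> u) x) = x"
  using assms end_algebra_closed[of u K V x] end_algebra_closed[of "inv\<^bsub>E\<^esub> u" K V x]
    end_algebra_unit_inv[OF vectorspace_axioms, of u x] by auto

lemma inj_imp_Units_E:
  assumes "f \<in> carrier E" "inj_on f (carrier V)"
  shows "f \<in> Units E"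
  using assms linear_endo_inj_imp_surj[OF finite_dimensional, of f]
  by (simp add: Units_end_algebra_iff_linear_iso vectorspace_axioms linear_iso_def bij_betw_def
      mem_end_algebra)

lemma self_adjoint_inv:
  assumes u: "u \<in> Units E" and "self_adjoint u"
  shows "self_adjoint (inv\<^bsub>E\<^esub> u)"
  unfolding self_adjoint_def
proof (intro ballI)
  fix x y assume xy: "x \<in> carrier V" "y \<in> carrier V"
  let ?w = "inv\<^bsub>E\<^esub> u"
  have w: "?w x \<in> carrier V" "?w y \<in> carrier V" using u xy by (auto intro: unit_inv_closed)
  have "b (?w x) y = b (?w x) (u (?w y))" using u xy by (simp add: unit_inv_right)
  also have "\<dots> = b (u (?w x)) (?w y)" using assms(2) w by (simp add: self_adjoint_def)
  also have "\<dots> = b x (?w y)" using u xy by (simp add: unit_inv_right)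
  finally show "b (?w x) y = b x (?w y)" .
qed

lemma twisted_form_unit:
  assumes "u \<in> Units E" "y \<in> carrier V"
  shows "twisted_form K V b u x (u y) = b x y"
  using assms by (simp add: twisted_form_def unit_inv_left)

text \<open>The twisted form is the pullback of \<open>b\<close> along the identity on the left and
  the inverse of \<open>u\<close> on the right.\<close>

lemma nondegenerate_twisted_form:
  assumes "u \<in> Units E"
  shows "nondegenerate_bilinear_space K V (twisted_form K V b u)"
  unfolding twisted_form_def
  using assms
  by (intro nondegenerate_pullback linear_iso_id Units_E_linear_iso vectorspace_axioms) simp

text \<open>With \<open>w\<close> the inverse of \<open>u\<close>, which is self-adjoint and
  commutes with \<open>\<alpha>\<close>: \<open>b (y, w \<alpha> x) = b (y, \<alpha> w x) = b (w x,
  y) = b (x, w y)\<close>.\<close>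

lemma asymmetry_twisted_form:
  assumes u: "u \<in> sym_units K V b"
  shows "asymmetry K V (twisted_form K V b u) = \<alpha>"
proof -
  have u: "u \<in> Units E" "self_adjoint u" using u by (auto simp: mem_sym_units)
  let ?w = "inv\<^bsub>E\<^esub> u"
  have w: "?w \<in> carrier E" "self_adjoint ?w" using u self_adjoint_inv by auto
  interpret T: nondegenerate_bilinear_space K V "twisted_form K V b u"
    using u(1) by (rule nondegenerate_twisted_form)
  interpret T: nondegenerate_space K V "twisted_form K V b u" ..
  show ?thesis
  proof (rule T.asymmetry_eqI[OF asymmetry_closed])
    fix x y assume xy: "x \<in> carrier V" "y \<in> carrier V"
    have "b y (?w (\<alpha> x)) = b y (\<alpha> (?w x))"
      using self_adjoint_asymmetry_commute[OF w xy(1)] by simp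
    also have "\<dots> = b (?w x) y" using u xy by (simp add: form_asymmetry unit_inv_closed)
    also have "\<dots> = b x (?w y)" using w xy by (simp add: self_adjoint_def)
    finally show "twisted_form K V b u y (\<alpha> x) = twisted_form K V b u x y"
      by (simp add: twisted_form_def)
  qed
qed

text \<open>The factor \<open>r\<close> occurs on both sides of the equation characterising an
  asymmetry, so carrying \<open>\<alpha>\<close> along \<open>g\<close> yields the asymmetry of
  \<open>c\<close>.\<close>

lemma isometry_conjugates_asymmetry:
  assumes c: "nondegenerate_bilinear_space K W c" and g: "linear_iso K V W g"
    and form: "\<And>x y. \<lbrakk>x \<in> carrier V; y \<in> carrier V\<rbrakk> \<Longrightarrow> c (g x) (g y) = r \<otimes>\<^bsub>K\<^esub> b x y"
  shows "conjugates_asymmetry K V b W c g"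
proof -
  interpret c: nondegenerate_bilinear_space K W c by fact
  interpret c: nondegenerate_space K W c ..
  let ?j = "inv_into (carrier V) g"
  have "linear_map K W W (\<lambda>w. g (\<alpha> (?j w)))"
    using linear_map_compose[OF linear_map_compose[OF linear_isoD(1)[OF linear_iso_inv[OF g]]]
        linear_isoD(1)[OF g], of \<alpha>] asymmetry_closed by (simp add: mem_end_algebra)
  then have "asymmetry K W c = (\<lambda>w\<in>carrier W. g (\<alpha> (?j w)))"
  proof (rule c.asymmetry_eqI[OF end_algebra_restrict])
    fix x y assume xy: "x \<in> carrier W" "y \<in> carrier W"
    have j: "?j x \<in> carrier V" "?j y \<in> carrier V" "g (?j x) = x" "g (?j y) = y"
      using xy linear_iso_apply[OF g] by auto
    have \<alpha>j: "\<alpha> (?j x) \<in> carrier V" using asymmetry_closed j(1) by (rule end_algebra_closed)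
    have "c y (g (\<alpha> (?j x))) = c (g (?j y)) (g (\<alpha> (?j x)))" by (simp add: j)
    also have "\<dots> = c (g (?j x)) (g (?j y))" using j(1,2) \<alpha>j by (simp only: form form_asymmetry)
    finally show "c y ((\<lambda>w\<in>carrier W. g (\<alpha> (?j w))) x) = c x y" using xy by (simp add: j)
  qed
  then show ?thesis using g by (simp add: conjugates_asymmetry_def)
qed

lemma twisted_form_conj_space:
  assumes "u \<in> sym_units K V b"
  shows "(V, twisted_form K V b u) \<in> conj_spaces K V b"
proof -
  \<comment> \<open>The identity is the conjugating map. Off the carrier, both sides of the next
    equation are \<open>undefined\<close> because \<open>\<alpha>\<close> is extensional.\<close>
  have "inv_into (carrier V) (\<lambda>x. x) x = x" if "x \<in> carrier V" for x
    using that by (intro inv_into_f_eq) auto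
  then have "(\<lambda>x\<in>carrier V. \<alpha> (inv_into (carrier V) (\<lambda>x. x) x)) = \<alpha>"
    using asymmetry_closed by (auto simp: mem_end_algebra extensional_def fun_eq_iff restrict_def)
  then have "conjugates_asymmetry K V b V (twisted_form K V b u) (\<lambda>x. x)"
    using assms
    by (simp add: conjugates_asymmetry_def asymmetry_twisted_form linear_iso_id vectorspace_axioms)
  then show ?thesis
    using assms nondegenerate_twisted_form by (auto simp: conj_spaces_def mem_sym_units)
qed

section \<open>Recovering the symmetric unit from a form with conjugate asymmetry\<close>

lemma conjugate_form_asymmetry:
  assumes c: "nondegenerate_bilinear_space K W c" and f: "conjugates_asymmetry K V b W c f"
    and xy: "x \<in> carrier V" "y \<in> carrier V"
  shows "c (f y) (f (\<alpha> x)) = c (f x) (f y)"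
proof -
  interpret c: nondegenerate_bilinear_space K W c by fact
  interpret c: nondegenerate_space K W c ..
  have iso: "linear_iso K V W f" using f by (simp add: conjugates_asymmetry_def)
  have "asymmetry K W c (f x) = f (\<alpha> x)"
    using f xy linear_iso_apply[OF iso] by (simp add: conjugates_asymmetry_def)
  then show ?thesis using c.form_asymmetry[of "f x" "f y"] xy linear_iso_closed[OF iso] by simp
qed

text \<open>The form pulled back along \<open>f\<close> is represented by an endomorphism
  \<open>w\<close>. Non-degeneracy of the pullback makes \<open>w\<close> injective, hence a unit,
  and \<open>u\<close> is its inverse.\<close>

lemma conjugate_form_representation:
  assumes c: "nondegenerate_bilinear_space K W c" and f: "conjugates_asymmetry K V b W c f"
  shows "\<exists>!u. u \<in> Units E \<and> (\<forall>x\<in>carrier V. \<forall>y\<in>carrier V. c (f x) (f y) = b x ((inv\<^bsub>E\<^esub> u) y))"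
proof (rule ex_ex1I)
  interpret c: nondegenerate_bilinear_space K W c by fact
  have iso: "linear_iso K V W f" using f by (simp add: conjugates_asymmetry_def)
  interpret P: nondegenerate_bilinear_space K V "\<lambda>x y. c (f x) (f y)"
    using iso iso by (rule c.nondegenerate_pullback)
  obtain w where w: "w \<in> carrier E"
    "\<And>x y. \<lbrakk>x \<in> carrier V; y \<in> carrier V\<rbrakk> \<Longrightarrow> c (f x) (f y) = b x (w y)"
    using form_representation[OF P.bilinear_space_axioms] by blast
  have "inj_on w (carrier V)"
    by (intro inj_onI P.right_cancel) (simp_all add: w(2))
  then have unit: "w \<in> Units E" using w(1) by (intro inj_imp_Units_E)
  show "\<exists>u. u \<in> Units E \<and> (\<forall>x\<in>carrier V. \<forall>y\<in>carrier V. c (f x) (f y) = b x ((inv\<^bsub>E\<^esub> u) y))"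
    using unit w(2) by (intro exI[of _ "inv\<^bsub>E\<^esub> w"]) (simp add: End.Units_inv_inv)
next
  fix u v
  assume u: "u \<in> Units E \<and> (\<forall>x\<in>carrier V. \<forall>y\<in>carrier V. c (f x) (f y) = b x ((inv\<^bsub>E\<^esub> u) y))"
    and v: "v \<in> Units E \<and> (\<forall>x\<in>carrier V. \<forall>y\<in>carrier V. c (f x) (f y) = b x ((inv\<^bsub>E\<^esub> v) y))"
  have "inv\<^bsub>E\<^esub> u = inv\<^bsub>E\<^esub> v"
    by (rule form_eqI) (use u v in auto)
  then show "u = v" using u v End.Units_inv_inv by metis
qed

lemma conjugate_form_sym_unit:
  assumes c: "nondegenerate_bilinear_space K W c" and f: "conjugates_asymmetry K V b W c f"
    and u: "u \<in> Units E"
    and form: "\<And>x y. \<lbrakk>x \<in> carrier V; y \<in> carrier V\<rbrakk> \<Longrightarrow> c (f x) (f y) = b x ((inv\<^bsub>E\<^esub> u) y)"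
  shows "u \<in> sym_units K V b"
proof -
  let ?w = "inv\<^bsub>E\<^esub> u"
  have w: "?w \<in> Units E" using u by simp
  have "self_adjoint ?w"
    unfolding self_adjoint_def
  proof (intro ballI)
    fix x y assume x: "x \<in> carrier V" and "y \<in> carrier V"
    \<comment> \<open>Writing \<open>y = \<alpha> z\<close> lets the asymmetry of \<open>b\<close>
      move \<open>?w x\<close> to the right argument, where \<open>form\<close> applies; the
      asymmetry of \<open>c\<close> then restores the order of the arguments.\<close>
    then obtain z where z: "z \<in> carrier V" "y = \<alpha> z" using asymmetry_surj by blast
    have "b (?w x) y = b z (?w x)" using w x z by (simp add: form_asymmetry unit_closed)
    also have "\<dots> = c (f z) (f x)" using x z by (simp add: form)
    also have "\<dots> = c (f x) (f y)" using conjugate_form_asymmetry[OF c f z(1) x] z by simp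
    also have "\<dots> = b x (?w y)" using x \<open>y \<in> carrier V\<close> by (rule form)
    finally show "b (?w x) y = b x (?w y)" .
  qed
  then have "self_adjoint u" using self_adjoint_inv[OF w] u by (simp add: End.Units_inv_inv)
  then show ?thesis using u by (simp add: mem_sym_units)
qed

section \<open>Equivalence of symmetric units and similarity of twisted forms\<close>

lemma sym_equiv_iff:
  "(u\<^sub>1, u\<^sub>2) \<in> sym_equiv K V b \<longleftrightarrow> u\<^sub>1 \<in> sym_units K V b \<and> u\<^sub>2 \<in> sym_units K V b \<and>
    (\<exists>v\<in>Units (asym_centralizer K V b). \<exists>r\<in>carrier K - {\<zero>\<^bsub>K\<^esub>}.
       \<forall>z\<in>carrier V. u\<^sub>2 z = r \<odot>\<^bsub>V\<^esub> v (u\<^sub>1 (adj v z)))"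
proof -
  \<comment> \<open>Both sides are extensional endomorphisms, so the equation in the algebra amounts
    to a pointwise one on the carrier.\<close>
  have eq: "u\<^sub>2 = r \<odot>\<^bsub>E\<^esub> (v \<otimes>\<^bsub>E\<^esub> u\<^sub>1 \<otimes>\<^bsub>E\<^esub> adj v) \<longleftrightarrow>
      (\<forall>z\<in>carrier V. u\<^sub>2 z = r \<odot>\<^bsub>V\<^esub> v (u\<^sub>1 (adj v z)))"
    if "u\<^sub>1 \<in> sym_units K V b" "u\<^sub>2 \<in> sym_units K V b" "v \<in> Units (asym_centralizer K V b)"
      "r \<in> carrier K - {\<zero>\<^bsub>K\<^esub>}" for v r
  proof -
    have cl: "u\<^sub>1 \<in> carrier E" "u\<^sub>2 \<in> carrier E" "v \<in> carrier E" "adj v \<in> carrier E"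
      using that by (auto simp: mem_sym_units Units_asym_centralizer intro: adjoint_closed)
    have "(r \<odot>\<^bsub>E\<^esub> (v \<otimes>\<^bsub>E\<^esub> u\<^sub>1 \<otimes>\<^bsub>E\<^esub> adj v)) z = r \<odot>\<^bsub>V\<^esub> v (u\<^sub>1 (adj v z))" if "z \<in> carrier V" for z
      using that end_algebra_closed[OF cl(4) that] by (simp add: end_algebra_sel compose_eq)
    moreover have "r \<odot>\<^bsub>E\<^esub> (v \<otimes>\<^bsub>E\<^esub> u\<^sub>1 \<otimes>\<^bsub>E\<^esub> adj v) \<in> carrier E"
      using that(4) cl by (intro end_algebra_smult) auto
    ultimately show ?thesis using end_algebra_eqI[OF cl(2)] by auto
  qed
  show ?thesis
    unfolding sym_equiv_def asym_centralizer_sel mem_Collect_eq prod.case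
    by (intro conj_cong bex_cong refl eq)
qed

text \<open>The unit \<open>v\<close> is itself a similarity, with factor the inverse of
  \<open>r\<close>: \<open>u\<^sub>2 = r v u\<^sub>1 (adj v)\<close> rearranges to \<open>(adj v)
  u\<^sub>2\<^sup>-\<^sup>1 v = r\<^sup>-\<^sup>1 u\<^sub>1\<^sup>-\<^sup>1\<close>.\<close>

lemma sym_equiv_imp_similar:
  assumes "(u\<^sub>1, u\<^sub>2) \<in> sym_equiv K V b"
  shows "similar K (V, twisted_form K V b u\<^sub>1) (V, twisted_form K V b u\<^sub>2)"
proof -
  have "u\<^sub>1 \<in> sym_units K V b" "u\<^sub>2 \<in> sym_units K V b"
    and ex: "\<exists>v\<in>Units (asym_centralizer K V b). \<exists>r\<in>carrier K - {\<zero>\<^bsub>K\<^esub>}.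
       \<forall>z\<in>carrier V. u\<^sub>2 z = r \<odot>\<^bsub>V\<^esub> v (u\<^sub>1 (adj v z))"
    using assms by (simp_all only: sym_equiv_iff)
  then have u: "u\<^sub>1 \<in> Units E" "u\<^sub>2 \<in> Units E" by (simp_all only: mem_sym_units)
  obtain v r where "v \<in> Units (asym_centralizer K V b)" and r: "r \<in> carrier K - {\<zero>\<^bsub>K\<^esub>}"
    and eq: "\<forall>z\<in>carrier V. u\<^sub>2 z = r \<odot>\<^bsub>V\<^esub> v (u\<^sub>1 (adj v z))"
    using ex by (elim bexE)
  then have v: "v \<in> Units E" by (simp only: Units_asym_centralizer)
  have vE: "v \<in> carrier E" using v by (rule End.Units_closed)
  show ?thesis
  proof (rule similarI[OF Units_E_linear_iso[OF v] inv_nonzero(1)[OF r]])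
    fix x y assume xy: "x \<in> carrier V" "y \<in> carrier V"
    \<comment> \<open>With \<open>s = adj v t\<close>, the formula for \<open>u\<^sub>2\<close> at
      \<open>t\<close> reads \<open>v y = v (r u\<^sub>1 s)\<close>. Cancelling \<open>v\<close> and
      then \<open>u\<^sub>1\<close> gives \<open>u\<^sub>1\<^sup>-\<^sup>1 y = r s\<close>.\<close>
    define t where "t = (inv\<^bsub>E\<^esub> u\<^sub>2) (v y)"
    have t: "t \<in> carrier V" using u v xy by (simp add: t_def unit_closed unit_inv_closed)
    define s where "s = adj v t"
    have s: "s \<in> carrier V" using adjoint_closed[OF vE] t by (auto simp: s_def intro: end_algebra_closed)
    have us: "u\<^sub>1 s \<in> carrier V" "u\<^sub>1 (r \<odot>\<^bsub>V\<^esub> s) = r \<odot>\<^bsub>V\<^esub> u\<^sub>1 s"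
      using u s r linear_map_smult[OF linear_isoD(1)[OF Units_E_linear_iso[OF u(1)]]]
      by (auto intro: unit_closed)
    have "v y = u\<^sub>2 t" using u v xy by (simp add: t_def unit_closed unit_inv_right)
    also have "\<dots> = v (r \<odot>\<^bsub>V\<^esub> u\<^sub>1 s)"
      using bspec[OF eq t] r us linear_map_smult[OF linear_isoD(1)[OF Units_E_linear_iso[OF v]]]
      by (simp add: s_def)
    finally have "y = u\<^sub>1 (r \<odot>\<^bsub>V\<^esub> s)"
      using unit_inv_left[OF v xy(2)] unit_inv_left[OF v, of "r \<odot>\<^bsub>V\<^esub> u\<^sub>1 s"] us r by simp
    then have "(inv\<^bsub>E\<^esub> u\<^sub>1) y = r \<odot>\<^bsub>V\<^esub> s" using u s r by (simp add: unit_inv_left)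
    then have "inv\<^bsub>K\<^esub> r \<otimes>\<^bsub>K\<^esub> twisted_form K V b u\<^sub>1 x y = inv\<^bsub>K\<^esub> r \<otimes>\<^bsub>K\<^esub> (r \<otimes>\<^bsub>K\<^esub> b x s)"
      using xy r s by (simp add: twisted_form_def form_smult_right)
    also have "\<dots> = (inv\<^bsub>K\<^esub> r \<otimes>\<^bsub>K\<^esub> r) \<otimes>\<^bsub>K\<^esub> b x s"
      using r inv_nonzero[OF r] xy s by (subst R.m_assoc) (auto intro: form_closed)
    also have "\<dots> = b x s" using inv_nonzero[OF r] xy s by (simp add: form_closed)
    also have "\<dots> = b (v x) t" using form_adjoint[OF vE xy(1) t] by (simp add: s_def)
    finally show "twisted_form K V b u\<^sub>2 (v x) (v y) = inv\<^bsub>K\<^esub> r \<otimes>\<^bsub>K\<^esub> twisted_form K V b u\<^sub>1 x y"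
      by (simp add: twisted_form_def t_def)
  qed
qed

text \<open>The similarity \<open>g\<close>, made extensional, serves as \<open>v\<close>, and the
  inverse of its factor as the scalar.\<close>

lemma similar_imp_sym_equiv:
  assumes u: "u\<^sub>1 \<in> sym_units K V b" "u\<^sub>2 \<in> sym_units K V b"
    and "similar K (V, twisted_form K V b u\<^sub>1) (V, twisted_form K V b u\<^sub>2)"
  shows "(u\<^sub>1, u\<^sub>2) \<in> sym_equiv K V b"
  using assms(3)
proof (rule similarE)
  fix g r assume g: "linear_iso K V V g" and r: "r \<in> carrier K - {\<zero>\<^bsub>K\<^esub>}"
    and form: "\<And>x y. \<lbrakk>x \<in> carrier V; y \<in> carrier V\<rbrakk> \<Longrightarrow>
      twisted_form K V b u\<^sub>2 (g x) (g y) = r \<otimes>\<^bsub>K\<^esub> twisted_form K V b u\<^sub>1 x y"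
  have U: "u\<^sub>1 \<in> Units E" "u\<^sub>2 \<in> Units E" using u by (auto simp: mem_sym_units)
  interpret T1: nondegenerate_bilinear_space K V "twisted_form K V b u\<^sub>1"
    using U(1) by (rule nondegenerate_twisted_form)
  interpret T1: nondegenerate_space K V "twisted_form K V b u\<^sub>1" ..
  \<comment> \<open>Both twisted forms have asymmetry \<open>\<alpha>\<close>, so \<open>g\<close>
    conjugates \<open>\<alpha>\<close> to itself, which puts \<open>v\<close> in the
    centralizer.\<close>
  have "conjugates_asymmetry K V (twisted_form K V b u\<^sub>1) V (twisted_form K V b u\<^sub>2) g"
    using nondegenerate_twisted_form[OF U(2)] g form by (rule T1.isometry_conjugates_asymmetry)
  then have \<alpha>: "\<alpha> = (\<lambda>w\<in>carrier V. g (\<alpha> (inv_into (carrier V) g w)))"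
    by (simp add: conjugates_asymmetry_def asymmetry_twisted_form u)
  define v where "v = restrict g (carrier V)"
  have vE: "v \<in> carrier E" using g by (simp add: v_def linear_isoD(1) end_algebra_restrict)
  have v: "v \<in> Units E"
    using vE linear_isoD(2)[OF g]
    by (intro inj_imp_Units_E) (auto simp: v_def bij_betw_def inj_on_def)
  have comm: "v (\<alpha> x) = \<alpha> (v x)" if x: "x \<in> carrier V" for x
  proof -
    have "\<alpha> (g x) = g (\<alpha> x)"
      using fun_cong[OF \<alpha>, of "g x"] linear_iso_apply[OF g] x by simp
    then show ?thesis using x end_algebra_closed[OF asymmetry_closed x] by (simp add: v_def)
  qed
  have "u\<^sub>2 z = inv\<^bsub>K\<^esub> r \<odot>\<^bsub>V\<^esub> v (u\<^sub>1 (adj v z))" if z: "z \<in> carrier V" for z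
  proof -
    \<comment> \<open>The vectors \<open>y\<close> and \<open>s\<close> are chosen so that
      \<open>v y = u\<^sub>2 z\<close> and \<open>u\<^sub>1 s = y\<close>. The similarity then
      identifies \<open>adj v z\<close> with \<open>r s\<close>, tested against every
      \<open>x\<close>; applying \<open>u\<^sub>1\<close> and \<open>v\<close> leads to
      \<open>r u\<^sub>2 z\<close>.\<close>
    define y where "y = (inv\<^bsub>E\<^esub> v) (u\<^sub>2 z)"
    have y: "y \<in> carrier V" "v y = u\<^sub>2 z"
      using v U z by (simp_all add: y_def unit_inv_closed unit_inv_right unit_closed)
    define s where "s = (inv\<^bsub>E\<^esub> u\<^sub>1) y"
    have s: "s \<in> carrier V" "u\<^sub>1 s = y" using U y by (simp_all add: s_def unit_inv_closed unit_inv_right)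
    have "adj v z = r \<odot>\<^bsub>V\<^esub> s"
    proof (rule right_cancel)
      show "adj v z \<in> carrier V" using adjoint_closed[OF vE] z by (rule end_algebra_closed)
      show "r \<odot>\<^bsub>V\<^esub> s \<in> carrier V" using r s by simp
      fix x assume x: "x \<in> carrier V"
      have "b x (adj v z) = b (v x) z" using vE x z by (rule form_adjoint)
      also have "\<dots> = twisted_form K V b u\<^sub>2 (v x) (v y)"
        using y twisted_form_unit[OF U(2) z] by simp
      also have "\<dots> = r \<otimes>\<^bsub>K\<^esub> twisted_form K V b u\<^sub>1 x y" using form[OF x y(1)] x y(1) by (simp add: v_def)
      also have "\<dots> = b x (r \<odot>\<^bsub>V\<^esub> s)" using x s r by (simp add: twisted_form_def s_def form_smult_right)
      finally show "b x (adj v z) = b x (r \<odot>\<^bsub>V\<^esub> s)" .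
    qed
    then have "u\<^sub>1 (adj v z) = r \<odot>\<^bsub>V\<^esub> y"
      using linear_map_smult[OF linear_isoD(1)[OF Units_E_linear_iso[OF U(1)]], of r s] r s by simp
    then have "v (u\<^sub>1 (adj v z)) = r \<odot>\<^bsub>V\<^esub> u\<^sub>2 z"
      using linear_map_smult[OF linear_isoD(1)[OF Units_E_linear_iso[OF v]], of r y] r y by simp
    then show ?thesis
      using smult_assoc1[of "inv\<^bsub>K\<^esub> r" r "u\<^sub>2 z"] inv_nonzero[OF r] r unit_closed[OF U(2) z] by simp
  qed
  moreover have "v \<in> Units (asym_centralizer K V b)"
    using v comm by (simp add: Units_asym_centralizer)
  ultimately show ?thesis
    unfolding sym_equiv_iff by (intro conjI u bexI[where x = v] bexI[where x = "inv\<^bsub>K\<^esub> r"] ballI inv_nonzero(1)[OF r])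
qed

end

section \<open>Representatives in the universe and passage to the quotients\<close>

lemma (in nondegenerate_space) conj_space_similar_twisted_form:
  assumes c: "nondegenerate_bilinear_space K W c" and f: "conjugates_asymmetry K V b W c f"
    and u: "u \<in> Units E"
    and form: "\<And>x y. \<lbrakk>x \<in> carrier V; y \<in> carrier V\<rbrakk> \<Longrightarrow> c (f x) (f y) = b x ((inv\<^bsub>E\<^esub> u) y)"
  shows "similar K (V, twisted_form K V b u) (W, c)"
proof -
  interpret T: nondegenerate_bilinear_space K V "twisted_form K V b u"
    using u by (rule nondegenerate_twisted_form)
  show ?thesis
    using f form
    by (intro similar_isometric[OF T.bilinear_space_axioms])
      (auto simp: conjugates_asymmetry_def twisted_form_def)
qed

text \<open>Carrying the twisted form to the copy of \<open>V\<close> given by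
  \<open>\<iota>\<close> ensures that every symmetric unit corresponds to some space over
  \<open>'w\<close>.\<close>

lemma (in nondegenerate_space) ex_conj_space_similar_twisted_form:
  fixes \<iota> :: "'v \<Rightarrow> 'w"
  assumes u: "u \<in> sym_units K V b" and "inj_on \<iota> (carrier V)"
  shows "\<exists>S \<in> conj_spaces K V b :: (('k, 'w) module \<times> ('w \<Rightarrow> 'w \<Rightarrow> 'k)) set.
    similar K (V, twisted_form K V b u) S"
proof -
  obtain W :: "('k, 'w) module" where iso: "linear_iso K V W \<iota>"
    using ex_linear_iso_of_inj_on[OF vectorspace_axioms assms(2)] by blast
  have U: "u \<in> Units E" using u by (simp add: mem_sym_units)
  interpret T: nondegenerate_bilinear_space K V "twisted_form K V b u"
    using U by (rule nondegenerate_twisted_form)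
  interpret T: nondegenerate_space K V "twisted_form K V b u" ..
  define c where "c x y = twisted_form K V b u (inv_into (carrier V) \<iota> x) (inv_into (carrier V) \<iota> y)"
    for x y
  have form: "c (\<iota> x) (\<iota> y) = twisted_form K V b u x y" if "x \<in> carrier V" "y \<in> carrier V" for x y
    using that by (simp add: c_def linear_iso_inv_left[OF iso])
  have c: "nondegenerate_bilinear_space K W c"
    unfolding c_def using linear_iso_inv[OF iso] by (intro T.nondegenerate_pullback)
  have "conjugates_asymmetry K V (twisted_form K V b u) W c \<iota>"
    using c iso by (rule T.isometry_conjugates_asymmetry[where r = "\<one>\<^bsub>K\<^esub>"])
      (simp add: form T.form_closed)
  \<comment> \<open>\<open>conjugates_asymmetry\<close> depends on the form on \<open>V\<close> only
    through its asymmetry, which \<open>b\<close> and the twisted form share.\<close>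
  then have "conjugates_asymmetry K V b W c \<iota>"
    by (simp add: conjugates_asymmetry_def asymmetry_twisted_form[OF u])
  then have "(W, c) \<in> conj_spaces K V b" using c by (auto simp: conj_spaces_def)
  moreover have "similar K (V, twisted_form K V b u) (W, c)"
    using T.bilinear_space_axioms iso form by (rule similar_isometric)
  ultimately show ?thesis by blast
qed

text \<open>A relation replaces a map because \<open>(V, twisted_form K V b u)\<close> lives over
  \<open>'v\<close>, while the spaces to be classified live over \<open>'w\<close>. Difunctionality
  makes all members of a class share their partners, so a class can be sent to the set of its
  partners. Totality on both sides makes this set a class and every class such a set.\<close>

lemma bij_betw_quotients:
  assumes r: "\<And>x y. (x, y) \<in> r \<longleftrightarrow> x \<in> A \<and> y \<in> A \<and> (\<exists>s\<in>B. R x s \<and> R y s)"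
    and s: "\<And>s t. (s, t) \<in> q \<longleftrightarrow> s \<in> B \<and> t \<in> B \<and> (\<exists>x\<in>A. R x s \<and> R x t)"
    and left_total: "\<And>x. x \<in> A \<Longrightarrow> \<exists>s\<in>B. R x s"
    and right_total: "\<And>s. s \<in> B \<Longrightarrow> \<exists>x\<in>A. R x s"
    and difunctional: "\<And>x y s t. \<lbrakk>x \<in> A; y \<in> A; s \<in> B; t \<in> B; R x s; R y s; R y t\<rbrakk> \<Longrightarrow> R x t"
  shows "bij_betw (\<lambda>X. {s \<in> B. \<exists>x\<in>X. R x s}) (A // r) (B // q)"
    and "x \<in> A \<Longrightarrow> {s \<in> B. \<exists>y\<in>r `` {x}. R y s} = {s \<in> B. R x s}"
    and "\<lbrakk>x \<in> A; s \<in> B; R x s\<rbrakk> \<Longrightarrow>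
      inv_into (A // r) (\<lambda>X. {s \<in> B. \<exists>x\<in>X. R x s}) (q `` {s}) = r `` {x}"
proof -
  let ?\<Phi> = "\<lambda>X. {s \<in> B. \<exists>x\<in>X. R x s}"
  have \<Phi>: "?\<Phi> (r `` {x}) = {s \<in> B. R x s}" if "x \<in> A" for x
  proof (intro equalityI subsetI)
    fix t assume "t \<in> ?\<Phi> (r `` {x})"
    then obtain y s where "t \<in> B" "y \<in> A" "s \<in> B" "R x s" "R y s" "R y t" by (auto simp: r)
    then show "t \<in> {s \<in> B. R x s}" using difunctional[OF that] by blast
  next
    fix t assume "t \<in> {s \<in> B. R x s}"
    then show "t \<in> ?\<Phi> (r `` {x})" using that by (auto simp: r intro!: bexI[of _ x])
  qed
  show "{s \<in> B. \<exists>y\<in>r `` {x}. R y s} = {s \<in> B. R x s}" if "x \<in> A"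
    using \<Phi>[OF that] by simp
  have \<Phi>_class: "?\<Phi> (r `` {x}) = q `` {s}" if "x \<in> A" "s \<in> B" "R x s" for x s
    unfolding \<Phi>[OF that(1)] using that by (auto simp: s intro: difunctional)
  have inj: "inj_on ?\<Phi> (A // r)"
  proof (rule inj_onI)
    fix X Y assume "X \<in> A // r" "Y \<in> A // r" and eq: "?\<Phi> X = ?\<Phi> Y"
    then obtain x y where xy: "x \<in> A" "y \<in> A" "X = r `` {x}" "Y = r `` {y}"
      by (auto elim!: quotientE)
    \<comment> \<open>Equal images mean that \<open>x\<close> and \<open>y\<close> have the same
      partners, and \<open>r\<close> is determined by partners.\<close>
    have R: "R x s \<longleftrightarrow> R y s" if "s \<in> B" for s
      using eq that unfolding xy(3,4) \<Phi>[OF xy(1)] \<Phi>[OF xy(2)] by blast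
    show "X = Y" using xy(1,2) R unfolding xy(3,4) by (auto simp: r)
  qed
  have "?\<Phi> ` (A // r) = B // q"
  proof (intro equalityI subsetI)
    fix Z assume "Z \<in> ?\<Phi> ` (A // r)"
    then obtain x where x: "x \<in> A" "Z = ?\<Phi> (r `` {x})" by (auto elim!: quotientE)
    obtain s where s: "s \<in> B" "R x s" using left_total[OF x(1)] by blast
    have "Z = q `` {s}" using x(2) \<Phi>_class[OF x(1) s] by (rule trans)
    then show "Z \<in> B // q" using quotientI[OF s(1)] by (rule ssubst)
  next
    fix Z assume "Z \<in> B // q"
    then have "\<exists>s\<in>B. Z = q `` {s}" unfolding quotient_def by simp
    then obtain s where s: "s \<in> B" "Z = q `` {s}" by (elim bexE)
    obtain x where x: "x \<in> A" "R x s" using right_total[OF s(1)] by blast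
    have "Z = ?\<Phi> (r `` {x})" using \<Phi>_class[OF x(1) s(1) x(2)] s(2) by simp
    then show "Z \<in> ?\<Phi> ` (A // r)" using quotientI[OF x(1)] by (rule image_eqI)
  qed
  then show "bij_betw ?\<Phi> (A // r) (B // q)" using inj by (simp add: bij_betw_def)
  show "inv_into (A // r) ?\<Phi> (q `` {s}) = r `` {x}" if "x \<in> A" "s \<in> B" "R x s"
    using inv_into_f_f[OF inj quotientI[OF that(1)]] unfolding \<Phi>_class[OF that] .
qed

theorem theorem3p3:
  fixes K :: "('k, 'r) ring_scheme"
    and V :: "('k, 'v) module"
    and b :: "'v \<Rightarrow> 'v \<Rightarrow> 'k"
    and \<iota> :: "'v \<Rightarrow> 'w"
  assumes "nondegenerate_bilinear_space K V b"
    and "inj_on \<iota> (carrier V)"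
  shows "\<exists>\<Phi> :: ('v \<Rightarrow> 'v) set \<Rightarrow> (('k, 'w) module \<times> ('w \<Rightarrow> 'w \<Rightarrow> 'k)) set.
    bij_betw \<Phi> (sym_units K V b // sym_equiv K V b) (conj_spaces K V b // similarity_rel K V b) \<and>
    (\<forall>u \<in> sym_units K V b.
       (V, twisted_form K V b u) \<in> conj_spaces K V b \<and>
       \<Phi> (sym_equiv K V b `` {u}) =
         {S \<in> conj_spaces K V b. similar K (V, twisted_form K V b u) S}) \<and>
    (\<forall>(V', b') \<in> conj_spaces K V b. \<forall>f. conjugates_asymmetry K V b V' b' f \<longrightarrow>
       (\<exists>!u. u \<in> Units (end_algebra K V) \<and>
          (\<forall>x\<in>carrier V. \<forall>y\<in>carrier V. b' (f x) (f y) = b x ((inv\<^bsub>end_algebra K V\<^esub> u) y))) \<and>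
       (\<forall>u. u \<in> Units (end_algebra K V) \<and>
          (\<forall>x\<in>carrier V. \<forall>y\<in>carrier V. b' (f x) (f y) = b x ((inv\<^bsub>end_algebra K V\<^esub> u) y)) \<longrightarrow>
          u \<in> sym_units K V b \<and>
          inv_into (sym_units K V b // sym_equiv K V b) \<Phi> (similarity_rel K V b `` {(V', b')}) =
            sym_equiv K V b `` {u}))"
proof -
  interpret nondegenerate_bilinear_space K V b by fact
  interpret nondegenerate_space K V b ..
  let ?A = "sym_units K V b" and ?r = "sym_equiv K V b"
  define B :: "(('k, 'w) module \<times> ('w \<Rightarrow> 'w \<Rightarrow> 'k)) set" where "B = conj_spaces K V b"
  define q :: "((('k, 'w) module \<times> ('w \<Rightarrow> 'w \<Rightarrow> 'k)) \<times> ('k, 'w) module \<times> ('w \<Rightarrow> 'w \<Rightarrow> 'k)) set"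
    where "q = similarity_rel K V b"
  \<comment> \<open>A unit is related to every space of the universe similar to its twisted form;
    \<open>similar\<close> may compare spaces over different types.\<close>
  define R where "R u S = similar K (V, twisted_form K V b u) S"
    for u and S :: "('k, 'w) module \<times> ('w \<Rightarrow> 'w \<Rightarrow> 'k)"
  have bil: "bilinear_space K V (twisted_form K V b u)" if "u \<in> ?A" for u
    using that nondegenerate_twisted_form[of u]
    by (simp add: mem_sym_units nondegenerate_bilinear_space_def)
  have bilB: "bilinear_space K (fst S) (snd S)" if "S \<in> B" for S
    using that by (auto simp: B_def conj_spaces_def nondegenerate_bilinear_space_def)
  have R_sym: "similar K S (V, twisted_form K V b u)" if "u \<in> ?A" "R u S" for u S
    using similar_sym[OF bil[OF that(1)], of "fst S" "snd S"] that(2) by (simp add: R_def)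
  have R_trans: "R u T" if "u \<in> ?A" "R u S" "similar K S T" for u S T
    using similar_trans[OF bil[OF that(1)], of "fst S" "snd S" "fst T" "snd T"] that(2,3)
    by (simp add: R_def)
  have S_trans: "similar K S T" if "S \<in> B" "similar K S (V, twisted_form K V b u)" "R u T" for u S T
    using similar_trans[OF bilB[OF that(1)], of V _ "fst T" "snd T"] that(2,3) by (simp add: R_def)
  have left_total: "\<exists>S\<in>B. R u S" if "u \<in> ?A" for u
    using ex_conj_space_similar_twisted_form[OF that assms(2)] by (simp add: B_def R_def)
  have rep: "u \<in> ?A" "R u (W, c)"
    if "(W, c) \<in> B" "conjugates_asymmetry K V b W c f" "u \<in> Units E"
      "\<forall>x\<in>carrier V. \<forall>y\<in>carrier V. c (f x) (f y) = b x ((inv\<^bsub>E\<^esub> u) y)" for W c f u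
    using that conjugate_form_sym_unit[of W c f u] conj_space_similar_twisted_form[of W c f u]
    by (auto simp: B_def R_def conj_spaces_def)
  have ex1: "\<exists>!u. u \<in> Units E \<and> (\<forall>x\<in>carrier V. \<forall>y\<in>carrier V. c (f x) (f y) = b x ((inv\<^bsub>E\<^esub> u) y))"
    if "(W, c) \<in> B" "conjugates_asymmetry K V b W c f" for W c f
    using that by (intro conjugate_form_representation) (auto simp: B_def conj_spaces_def)
  have right_total: "\<exists>u\<in>?A. R u S" if "S \<in> B" for S
  proof -
    obtain W c f where S: "S = (W, c)" and f: "conjugates_asymmetry K V b W c f"
      using \<open>S \<in> B\<close> by (auto simp: B_def conj_spaces_def)
    then show ?thesis using ex1[of W c f] rep[of W c f] \<open>S \<in> B\<close> by blast
  qed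
  \<comment> \<open>A space similar to both twisted forms links them to each other. Conversely, a
    partner of \<open>v\<close> exists by \<open>left_total\<close> and is also a partner of
    \<open>u\<close> when the two are equivalent.\<close>
  have r: "(u, v) \<in> ?r \<longleftrightarrow> u \<in> ?A \<and> v \<in> ?A \<and> (\<exists>S\<in>B. R u S \<and> R v S)" for u v
  proof (intro iffI conjI)
    assume uv: "(u, v) \<in> ?r"
    then show A: "u \<in> ?A" "v \<in> ?A" by (simp_all add: sym_equiv_iff)
    then obtain S where S: "S \<in> B" "R v S" using left_total by blast
    have "R u S"
      using similar_trans[OF bil[OF A(1)], of V _ "fst S" "snd S"] sym_equiv_imp_similar[OF uv] S(2)
      by (simp add: R_def)
    then show "\<exists>S\<in>B. R u S \<and> R v S" using S by blast
  next
    assume *: "u \<in> ?A \<and> v \<in> ?A \<and> (\<exists>S\<in>B. R u S \<and> R v S)"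
    then obtain S where S: "R u S" "R v S" by blast
    have "similar K (V, twisted_form K V b u) (V, twisted_form K V b v)"
      using similar_trans[OF bil, of u "fst S" "snd S"] S(1) R_sym[OF _ S(2)] * by (simp add: R_def)
    then show "(u, v) \<in> ?r" using * similar_imp_sym_equiv by blast
  qed
  have q: "(S, T) \<in> q \<longleftrightarrow> S \<in> B \<and> T \<in> B \<and> (\<exists>u\<in>?A. R u S \<and> R u T)" for S T
  proof -
    have "(S, T) \<in> q \<longleftrightarrow> S \<in> B \<and> T \<in> B \<and> similar K S T"
      by (simp add: q_def similarity_rel_def B_def)
    then show ?thesis using right_total R_sym R_trans S_trans by metis
  qed
  \<comment> \<open>The spaces \<open>S\<close> and \<open>T\<close> are similar through the twisted
    form of \<open>v\<close>, so similarity of \<open>S\<close> to the twisted form of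
    \<open>u\<close> passes on to \<open>T\<close>.\<close>
  have difunctional: "R u T" if "u \<in> ?A" "v \<in> ?A" "S \<in> B" "T \<in> B" "R u S" "R v S" "R v T" for u v S T
    using that R_trans R_sym S_trans by metis
  define \<Phi> where "\<Phi> = (\<lambda>X. {S \<in> B. \<exists>u\<in>X. R u S})"
  note corr = bij_betw_quotients[where A = ?A and r = ?r and B = B and q = q and R = R, folded \<Phi>_def]
  have bij: "bij_betw \<Phi> (?A // ?r) (B // q)"
    by (rule corr(1)) (fact r q left_total right_total difunctional)+
  have \<Phi>_class: "\<Phi> (?r `` {u}) = {S \<in> B. R u S}" if "u \<in> ?A" for u
    unfolding \<Phi>_def
    by (rule corr(2)) (fact r q left_total right_total difunctional that)+
  have \<Phi>_inv: "inv_into (?A // ?r) \<Phi> (q `` {S}) = ?r `` {u}" if "u \<in> ?A" "S \<in> B" "R u S" for u S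
    by (rule corr(3)) (fact r q left_total right_total difunctional that)+
  show ?thesis
  proof (intro exI[of _ \<Phi>] conjI ballI)
    show "bij_betw \<Phi> (?A // ?r) (conj_spaces K V b // similarity_rel K V b)"
      using bij by (simp only: B_def q_def)
    fix u assume u: "u \<in> ?A"
    show "(V, twisted_form K V b u) \<in> conj_spaces K V b" using u by (rule twisted_form_conj_space)
    show "\<Phi> (?r `` {u}) = {S \<in> conj_spaces K V b. similar K (V, twisted_form K V b u) S}"
      using \<Phi>_class[OF u] by (simp only: B_def R_def)
  next
    fix S :: "('k, 'w) module \<times> ('w \<Rightarrow> 'w \<Rightarrow> 'k)"
    assume S: "S \<in> conj_spaces K V b"
    show "case S of (V', b') \<Rightarrow> \<forall>f. conjugates_asymmetry K V b V' b' f \<longrightarrow>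
       (\<exists>!u. u \<in> Units E \<and>
          (\<forall>x\<in>carrier V. \<forall>y\<in>carrier V. b' (f x) (f y) = b x ((inv\<^bsub>E\<^esub> u) y))) \<and>
       (\<forall>u. u \<in> Units E \<and>
          (\<forall>x\<in>carrier V. \<forall>y\<in>carrier V. b' (f x) (f y) = b x ((inv\<^bsub>E\<^esub> u) y)) \<longrightarrow>
          u \<in> ?A \<and> inv_into (?A // ?r) \<Phi> (similarity_rel K V b `` {(V', b')}) = ?r `` {u})"
    proof (clarify, intro conjI allI impI)
      fix W c f assume "S = (W, c)" and f: "conjugates_asymmetry K V b W c f"
      then have WB: "(W, c) \<in> B" using S by (simp add: B_def)
      show "\<exists>!u. u \<in> Units E \<and> (\<forall>x\<in>carrier V. \<forall>y\<in>carrier V. c (f x) (f y) = b x ((inv\<^bsub>E\<^esub> u) y))"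
        using WB f by (rule ex1)
      fix u assume "u \<in> Units E \<and> (\<forall>x\<in>carrier V. \<forall>y\<in>carrier V. c (f x) (f y) = b x ((inv\<^bsub>E\<^esub> u) y))"
      then have u: "u \<in> ?A" "R u (W, c)" using rep[OF WB f] by blast+
      then show "u \<in> ?A" by blast
      show "inv_into (?A // ?r) \<Phi> (similarity_rel K V b `` {(W, c)}) = ?r `` {u}"
        using \<Phi>_inv[OF u(1) WB u(2)] by (simp only: q_def)
    qed
  qed
qed

end
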